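(* Let $m_1,m_2,m_3\in\mathbb N$ and $m=m_1+m_2+m_3$. Let $\mathcal T_{2,4,4}$ be the set of partitions $\pi$ of $[m]$ such that $T^\pi_{m_1,m_2,m_3}$ is of $2$-$4$-$4$ tree type. Then $$|\mathcal T_{2,4,4}|=4\,|\mathcal{PS}^{(2,1,1)}_{NC_2}(m_1,m_2,m_3)|.$$
   Context: $\gamma=\gamma_{m_1,m_2,m_3}$ is the permutation of $[m]$ with three cycles, the $j$-th being $[\![m_j]\!]=(m_1+\cdots+m_{j-1}+1,\dots,m_1+\cdots+m_j)$. $T_{m_1,m_2,m_3}$ is the oriented graph with vertex set $[m]$ and edges $e_1,\dots,e_m$, $e_i$ going from $\gamma(i)$ to $i$; it is the disjoint union of basic cycles $T_{m_1},T_{m_2},T_{m_3}$. For a partition $\pi$ of $[m]$, the quotient graph $T^\pi_{m_1,m_2,m_3}$ has the blocks of $\pi$ as vertices and edges $e_1,\dots,e_m$, $e_i$ going from the block of $\gamma(i)$ to the block of $i$; $T^\pi_{m_j}$ is the quotient of $T_{m_j}$ by the restriction of $\pi$ to $[\![m_j]\!]$. Two edges are equivalent if they join the same unordered pair of vertices; the elementarization (denoted by an overline) is the unoriented graph on the same vertices whose edges are the equivalence classes; multiplicity is the cardinality of the class. $T^\pi_{m_j}$ is a double tree if $\overline{T^\pi_{m_j}}$ is a tree and every edge has multiplicity 2 and consists of two edges with opposite orientations. $T^\pi_{m_1,m_2,m_3}$ is of $2$-$4$-$4$ tree type if $T^\pi_{m_1},T^\pi_{m_2},T^\pi_{m_3}$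 are double trees and $T^\pi_{m_1,m_2,m_3}$ is obtained by joining them along two distinct edges, each having multiplicity 4 in $\overline{T^\pi_{m_1,m_2,m_3}}$: for some $\{i,j,k\}=\{1,2,3\}$, an edge of $T^\pi_{m_j}$ is glued to an edge of $T^\pi_{m_i}$ and a different edge of $T^\pi_{m_j}$ is glued to an edge of $T^\pi_{m_k}$, the only vertex identifications between the trees being those generated by these gluings. $NC_2(m_i)$ is the set of non-crossing pairings of the cyclically ordered set $[\![m_i]\!]$, regarded as permutations. $\mathcal{PS}^{(2,1,1)}_{NC_2}(m_1,m_2,m_3)$ is the set of pairs $(\mathcal V,\pi)$ with $\pi=\pi_1\times\pi_2\times\pi_3\in S_m$, $\pi_i\in NC_2(m_i)$, and $\mathcal V$ a partition of $[m]$ each of whose blocks is a cycle of $\pi$, except two blocks, each the union of two cycles of $\pi$, such that the join of $\mathcal V$ with the cycle partition of $\gamma$ is the one-block partition of $[m]$ (i.e. for some permutation $(i_1,i_2,i_3)$ of $(1,2,3)$ one of these blocks joins a cycle of $\pi_{i_1}$ and a cycle of $\pi_{i_2}$, and the other joins another cycle of $\pi_{i_2}$ and a cycle of $\pi_{i_3}$). *)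

theory Defs
  imports
    "HOL-Library.Disjoint_Sets"
    "HOL-Combinatorics.Permutations"
    "HOL-Combinatorics.Cycles"
    "HOL-Combinatorics.Orbits"
    "Graph_Theory.Digraph"
begin

section \<open>Partitions\<close>

definition part_rel :: "'a set set \<Rightarrow> ('a \<times> 'a) set" where
  "part_rel P = {(x, y). \<exists>B\<in>P. x \<in> B \<and> y \<in> B}"

definition block_of :: "'a set set \<Rightarrow> 'a \<Rightarrow> 'a set" where
  "block_of P x = (THE B. B \<in> P \<and> x \<in> B)"

definition restrict_part :: "'a set set \<Rightarrow> 'a set \<Rightarrow> 'a set set" where
  "restrict_part P S = {B \<inter> S | B. B \<in> P} - {{}}"

text \<open>The finest partition of \<open>A\<close> in which any two elements related by \<open>R \<subseteq> A \<times> A\<close> share a block.\<close>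

definition generated_part :: "'a set \<Rightarrow> ('a \<times> 'a) set \<Rightarrow> 'a set set" where
  "generated_part A R = A // Restr ((R \<union> R\<inverse>)\<^sup>*) A"

definition part_join :: "'a set \<Rightarrow> 'a set set \<Rightarrow> 'a set set \<Rightarrow> 'a set set" where
  "part_join A P Q = generated_part A (part_rel P \<union> part_rel Q)"

text \<open>The orbits of \<open>p\<close> on \<open>A\<close>, fixed points included.\<close>

definition cycle_part :: "'a set \<Rightarrow> ('a \<Rightarrow> 'a) \<Rightarrow> 'a set set" where
  "cycle_part A p = orbit p ` A"


section \<open>Unoriented multigraphs\<close>

text \<open>
  An edge \<open>e\<close> has the set \<open>uends G e\<close> of one (loop) or two end vertices. The notion \<open>tree\<close> of
  \<open>Graph_Theory\<close> is not suitable here: it only excludes directed cycles.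
\<close>

record ('v, 'e) ugraph =
  uverts :: "'v set"
  uedges :: "'e set"
  uends :: "'e \<Rightarrow> 'v set"

definition uadj :: "('v, 'e) ugraph \<Rightarrow> ('v \<times> 'v) set" where
  "uadj G = {(u, v). \<exists>e\<in>uedges G. uends G e = {u, v}}"

definition uconnected :: "('v, 'e) ugraph \<Rightarrow> bool" where
  "uconnected G \<longleftrightarrow> uverts G \<noteq> {} \<and> (\<forall>u\<in>uverts G. \<forall>v\<in>uverts G. (u, v) \<in> (uadj G)\<^sup>*)"

text \<open>
  Loops (length 1) and pairs of parallel edges (length 2) count as cycles.
\<close>

definition ucycle :: "('v, 'e) ugraph \<Rightarrow> 'v list \<Rightarrow> 'e list \<Rightarrow> bool" where
  "ucycle G vs es \<longleftrightarrow>
     es \<noteq> [] \<and> length vs = length es \<and> distinct vs \<and> distinct es \<and>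
     set vs \<subseteq> uverts G \<and> set es \<subseteq> uedges G \<and>
     (\<forall>i<length es. uends G (es ! i) = {vs ! i, vs ! (Suc i mod length vs)})"

definition utree :: "('v, 'e) ugraph \<Rightarrow> bool" where
  "utree G \<longleftrightarrow> uconnected G \<and> (\<nexists>vs es. ucycle G vs es)"


section \<open>Quotients, elementarization, double trees\<close>

definition quotient_graph :: "'v set set \<Rightarrow> ('v, 'e) pre_digraph \<Rightarrow> ('v set, 'e) pre_digraph" where
  "quotient_graph P G =
     \<lparr>verts = P, arcs = arcs G,
      tail = (\<lambda>e. block_of P (tail G e)), head = (\<lambda>e. block_of P (head G e))\<rparr>"

definition ends :: "('v, 'e) pre_digraph \<Rightarrow> 'e \<Rightarrow> 'v set" where
  "ends G e = {tail G e, head G e}"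

definition edge_equiv :: "('v, 'e) pre_digraph \<Rightarrow> ('e \<times> 'e) set" where
  "edge_equiv G = {(e, f). e \<in> arcs G \<and> f \<in> arcs G \<and> ends G e = ends G f}"

text \<open>All members of an equivalence class \<open>c\<close> of edges have the same ends, so the union is that set.\<close>

definition elementarization :: "('v, 'e) pre_digraph \<Rightarrow> ('v, 'e set) ugraph" where
  "elementarization G =
     \<lparr>uverts = verts G, uedges = arcs G // edge_equiv G, uends = (\<lambda>c. \<Union>e\<in>c. ends G e)\<rparr>"

abbreviation edge_class :: "('v, 'e) pre_digraph \<Rightarrow> 'e \<Rightarrow> 'e set" where
  "edge_class G e \<equiv> edge_equiv G `` {e}"

definition double_tree :: "('v, 'e) pre_digraph \<Rightarrow> bool" where
  "double_tree G \<longleftrightarrow>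
     utree (elementarization G) \<and>
     (\<forall>c\<in>uedges (elementarization G).
        card c = 2 \<and> (\<forall>e\<in>c. \<forall>f\<in>c. e \<noteq> f \<longrightarrow> tail G e = head G f \<and> head G e = tail G f))"


section \<open>The permutation \<open>\<gamma>\<close> and the graphs built from it\<close>

text \<open>
  The cycle lengths are given as a list \<open>ms\<close>; positions in \<open>ms\<close> are counted from 0, while the
  permuted points are \<open>1, \<dots>, sum_list ms\<close>.
\<close>

definition seg_list :: "nat list \<Rightarrow> nat \<Rightarrow> nat list" where
  "seg_list ms j = [Suc (sum_list (take j ms)) ..< Suc (sum_list (take (Suc j) ms))]"

abbreviation seg :: "nat list \<Rightarrow> nat \<Rightarrow> nat set" where
  "seg ms j \<equiv> set (seg_list ms j)"

abbreviation points :: "nat list \<Rightarrow> nat set" where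
  "points ms \<equiv> {1..sum_list ms}"

definition gamma :: "nat list \<Rightarrow> nat \<Rightarrow> nat" where
  "gamma ms = foldr (\<circ>) (map (\<lambda>j. cycle_of_list (seg_list ms j)) [0..<length ms]) id"

text \<open>The edge \<open>e\<^sub>i\<close> is represented by its index \<open>i\<close>; it goes from \<open>\<gamma> i\<close> to \<open>i\<close>.\<close>

definition cycles_graph :: "nat list \<Rightarrow> (nat, nat) pre_digraph" where
  "cycles_graph ms = \<lparr>verts = points ms, arcs = points ms, tail = gamma ms, head = id\<rparr>"

definition cycle_graph :: "nat list \<Rightarrow> nat \<Rightarrow> (nat, nat) pre_digraph" where
  "cycle_graph ms j = \<lparr>verts = seg ms j, arcs = seg ms j, tail = gamma ms, head = id\<rparr>"

abbreviation cycles_quotient :: "nat list \<Rightarrow> nat set set \<Rightarrow> (nat set, nat) pre_digraph" where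
  "cycles_quotient ms P \<equiv> quotient_graph P (cycles_graph ms)"

abbreviation cycle_quotient :: "nat list \<Rightarrow> nat set set \<Rightarrow> nat \<Rightarrow> (nat set, nat) pre_digraph" where
  "cycle_quotient ms P j \<equiv> quotient_graph (restrict_part P (seg ms j)) (cycle_graph ms j)"


section \<open>The 2-4-4 tree type\<close>

text \<open>
  An edge \<open>p\<close> can be glued to an edge \<open>q\<close> in two ways: preserving or reversing their orientations.
  Each way is given as the set of pairs of vertices to be identified. In a quotient by a double tree,
  replacing \<open>p\<close> or \<open>q\<close> by its oppositely oriented partner only exchanges the two ways.
\<close>

definition edge_gluings :: "('v, 'e) pre_digraph \<Rightarrow> 'e \<Rightarrow> 'e \<Rightarrow> ('v \<times> 'v) set set" where
  "edge_gluings G p q =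
     {{(tail G p, tail G q), (head G p, head G q)},
      {(tail G p, head G q), (head G p, tail G q)}}"

text \<open>
  The last conjunct says that \<open>P\<close> makes no identifications other than those within the three trees
  and those generated by the two gluings.
\<close>

definition tree_type_244 :: "nat list \<Rightarrow> nat set set \<Rightarrow> bool" where
  "tree_type_244 ms P \<longleftrightarrow>
     (\<forall>j<3. double_tree (cycle_quotient ms P j)) \<and>
     (\<exists>i j k. {i, j, k} = {0, 1, 2} \<and>
        (\<exists>p\<in>seg ms j. \<exists>q\<in>seg ms i. \<exists>p'\<in>seg ms j. \<exists>q'\<in>seg ms k.
         \<exists>g\<in>edge_gluings (cycles_graph ms) p q. \<exists>g'\<in>edge_gluings (cycles_graph ms) p' q'.
           edge_class (cycle_quotient ms P j) p \<noteq> edge_class (cycle_quotient ms P j) p' \<and>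
           card (edge_class (cycles_quotient ms P) p) = 4 \<and>
           card (edge_class (cycles_quotient ms P) p') = 4 \<and>
           P = generated_part (points ms)
                 ((\<Union>l<3. part_rel (restrict_part P (seg ms l))) \<union> g \<union> g')))"

definition T244 :: "nat \<Rightarrow> nat \<Rightarrow> nat \<Rightarrow> nat set set set" where
  "T244 m1 m2 m3 =
     {P. partition_on {1..m1 + m2 + m3} P \<and> tree_type_244 [m1, m2, m3] P}"


section \<open>Non-crossing pairings and partitioned permutations\<close>

text \<open>
  Crossing is invariant under rotation, so that on a segment the linear order of \<open>nat\<close> gives the
  same notion as the cyclic order.
\<close>

definition NC2 :: "nat set \<Rightarrow> (nat \<Rightarrow> nat) set" where
  "NC2 S = {p. p permutes S \<and> (\<forall>x\<in>S. p x \<noteq> x \<and> p (p x) = x) \<and>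
     \<not> (\<exists>a\<in>S. \<exists>b\<in>S. a < b \<and> b < p a \<and> p a < p b)}"

definition PS_NC2_211 :: "nat \<Rightarrow> nat \<Rightarrow> nat \<Rightarrow> (nat set set \<times> (nat \<Rightarrow> nat)) set" where
  "PS_NC2_211 m1 m2 m3 =
     (let ms = [m1, m2, m3]; A = {1..m1 + m2 + m3} in
      {(V, p).
         (\<exists>p1\<in>NC2 (seg ms 0). \<exists>p2\<in>NC2 (seg ms 1). \<exists>p3\<in>NC2 (seg ms 2). p = p1 \<circ> p2 \<circ> p3) \<and>
         partition_on A V \<and>
         (\<exists>B1\<in>V. \<exists>B2\<in>V. B1 \<noteq> B2 \<and>
            (\<forall>B\<in>{B1, B2}. \<exists>C\<in>cycle_part A p. \<exists>D\<in>cycle_part A p. C \<noteq> D \<and> B = C \<union> D) \<and>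
            (\<forall>B\<in>V - {B1, B2}. B \<in> cycle_part A p)) \<and>
         part_join A V (cycle_part A (gamma ms)) = {A}})"

end

(*
  A double tree is traversed by the walk x -> g x, and removing an edge of a tree disconnects it.
  This is recorded by cuts: two-valued functions, constant on the vertices of the quotient, that
  change exactly along one edge class. For a segment, a pairing admits all its cuts iff it is
  non-crossing, and the cuts force the vertex partition to be the one generated by
  g (p x) ~ x; hence double trees correspond to non-crossing pairings. Cuts extend over gluings along
  edges (constantly over the other tree, or by matching the two sides at the glued edge), so the edge
  classes of a glued graph are the pairs, except that glued pairs are merged. Reading off
  the edge classes and the pairing thus maps the tree-type partitions to partitioned permutations,
  and a fibre consists of the 2 * 2 choices of orientations of the two gluings. These are distinct
  because there are no loops.
*)

theory Submission
  imports Defs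
begin

section \<open>Partitions and the relations they generate\<close>

text \<open>That a generated partition identifies two points is easy to show. The obstacle is the
  opposite: the gluings must create no loop, no further parallel edges and no new identification
  inside a tree. A function that agrees on all generating pairs is an invariant of the closure, and
  this makes cuts the right certificate: they are written down on generators and pass to the
  generated partition unchanged.

  A second difficulty is that the partition does not determine the data of the gluing, that is, the
  indices \<open>i\<close>, \<open>j\<close>, \<open>k\<close> and the chosen edges: an edge may be
  replaced by its partner under \<open>\<pi>\<close>, and the two outer trees may change roles. The
  count therefore rests on the relation \<open>reads_off\<close>, which mentions only edge classes
  and is independent of such choices.\<close>

lemma equiv_part_rel: "partition_on A P \<Longrightarrow> equiv A (part_rel P)"
  unfolding part_rel_def by (rule equiv_partition_on)

lemma quotient_part_rel: "partition_on A P \<Longrightarrow> A // part_rel P = P"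
  unfolding part_rel_def by (rule partition_on_eq_quotient)

lemma part_rel_inject:
  "partition_on A P \<Longrightarrow> partition_on A Q \<Longrightarrow> part_rel P = part_rel Q \<Longrightarrow> P = Q"
  by (metis quotient_part_rel)

lemma part_rel_refl: "partition_on A P \<Longrightarrow> x \<in> A \<Longrightarrow> (x, x) \<in> part_rel P"
  by (auto simp: part_rel_def partition_on_def)

lemma part_rel_sym: "(x, y) \<in> part_rel P \<Longrightarrow> (y, x) \<in> part_rel P"
  by (auto simp: part_rel_def)

lemma part_rel_trans:
  "partition_on A P \<Longrightarrow> (x, y) \<in> part_rel P \<Longrightarrow> (y, z) \<in> part_rel P \<Longrightarrow> (x, z) \<in> part_rel P"
  by (metis equiv_part_rel equiv_def transD)

lemma part_rel_mem: "partition_on A P \<Longrightarrow> (x, y) \<in> part_rel P \<Longrightarrow> x \<in> A \<and> y \<in> A"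
  by (auto simp: part_rel_def partition_on_def)

lemma part_rel_quotient: "equiv A r \<Longrightarrow> part_rel (A // r) = r"
proof -
  assume r: "equiv A r"
  have P: "partition_on A (A // r)"
    using r by (rule partition_on_quotient)
  show ?thesis
  proof (intro set_eqI iffI; clarify)
    fix x y assume "(x, y) \<in> part_rel (A // r)"
    then show "(x, y) \<in> r"
      using r unfolding part_rel_def by (auto intro: quotient_eq_iff[THEN iffD1])
  next
    fix x y assume xy: "(x, y) \<in> r"
    then have "x \<in> A" using r by (auto simp: equiv_class_eq_iff)
    then have "r `` {x} \<in> A // r" "x \<in> r `` {x}" "y \<in> r `` {x}"
      using xy equiv_class_self[OF r] by (auto intro: quotientI)
    then show "(x, y) \<in> part_rel (A // r)" by (auto simp: part_rel_def)
  qed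
qed

lemma equiv_generated: "equiv A (Restr ((R \<union> R\<inverse>)\<^sup>*) A)"
proof -
  have "sym ((R \<union> R\<inverse>)\<^sup>*)"
    by (intro sym_rtrancl) (auto simp: sym_def)
  then show ?thesis
    by (auto simp: equiv_def refl_on_def sym_def trans_def intro: rtrancl_trans)
qed

lemma partition_on_generated: "partition_on A (generated_part A R)"
  unfolding generated_part_def by (intro partition_on_quotient equiv_generated)

lemma part_rel_generated: "part_rel (generated_part A R) = Restr ((R \<union> R\<inverse>)\<^sup>*) A"
  unfolding generated_part_def by (intro part_rel_quotient equiv_generated)

lemma generated_part_superset: "R \<subseteq> A \<times> A \<Longrightarrow> R \<subseteq> part_rel (generated_part A R)"
  unfolding part_rel_generated by auto

lemma generated_part_least:
  assumes P: "partition_on A P" and R: "R \<subseteq> part_rel P"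
  shows "part_rel (generated_part A R) \<subseteq> part_rel P"
proof -
  have "(x, y) \<in> part_rel P" if "x \<in> A" "(x, y) \<in> (R \<union> R\<inverse>)\<^sup>*" for x y
    using that(2,1)
  proof (induction rule: rtrancl_induct)
    case base
    then show ?case by (rule part_rel_refl[OF P])
  next
    case (step y z)
    then have "(y, z) \<in> part_rel P" using R by (auto intro: part_rel_sym)
    with step show ?case by (blast intro: part_rel_trans[OF P])
  qed
  then show ?thesis unfolding part_rel_generated by auto
qed

text \<open>This is the tool for keeping points apart: two points lie in different blocks as soon as
  some function agrees on every generating pair but differs at them.\<close>

lemma generated_part_respects:
  assumes "\<forall>(u, v)\<in>R. f u = f v" and "(x, y) \<in> part_rel (generated_part A R)"
  shows "f x = f y"
proof -
  have "(x, y) \<in> (R \<union> R\<inverse>)\<^sup>*" using assms(2) unfolding part_rel_generated by auto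
  then show ?thesis
    by (induction rule: rtrancl_induct) (use assms(1) in auto)
qed

lemma block_of_mem:
  assumes "partition_on A P" "x \<in> A"
  shows "block_of P x \<in> P \<and> x \<in> block_of P x"
proof -
  have "\<exists>!B. B \<in> P \<and> x \<in> B"
    using assms by (auto simp: partition_on_def disjoint_def)
  then show ?thesis unfolding block_of_def by (rule theI')
qed

lemma block_of_eqI:
  assumes "partition_on A P" "B \<in> P" "x \<in> B"
  shows "block_of P x = B"
  using assms block_of_mem[of A P x] by (auto simp: partition_on_def disjoint_def)

lemma block_of_eq_iff:
  assumes "partition_on A P" "x \<in> A" "y \<in> A"
  shows "block_of P x = block_of P y \<longleftrightarrow> (x, y) \<in> part_rel P"
proof
  assume "block_of P x = block_of P y"
  then show "(x, y) \<in> part_rel P"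
    using block_of_mem[OF assms(1)] assms(2,3) by (auto simp: part_rel_def)
next
  assume "(x, y) \<in> part_rel P"
  then show "block_of P x = block_of P y"
    using block_of_eqI[OF assms(1)] by (auto simp: part_rel_def)
qed

lemma partition_on_restrict_part:
  assumes "partition_on A P" "S \<subseteq> A"
  shows "partition_on S (restrict_part P S)"
proof -
  have "restrict_part P S = (\<inter>) S ` P - {{}}"
    by (auto simp: restrict_part_def)
  then show ?thesis
    using partition_on_restrict[OF assms(1), of S] assms(2) by (simp add: Int_absorb2)
qed

lemma part_rel_restrict_part: "part_rel (restrict_part P S) = Restr (part_rel P) S"
proof (rule subset_antisym)
  show "part_rel (restrict_part P S) \<subseteq> Restr (part_rel P) S"
    unfolding restrict_part_def part_rel_def by auto
  show "Restr (part_rel P) S \<subseteq> part_rel (restrict_part P S)"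
  proof clarify
    fix x y assume "(x, y) \<in> part_rel P" "x \<in> S" "y \<in> S"
    then obtain B where B: "B \<in> P" "x \<in> B \<inter> S" "y \<in> B \<inter> S"
      unfolding part_rel_def by blast
    then have "B \<inter> S \<in> restrict_part P S"
      unfolding restrict_part_def by blast
    then show "(x, y) \<in> part_rel (restrict_part P S)"
      using B(2,3) by (simp add: part_rel_def) (intro bexI[of _ "B \<inter> S"]; simp)
  qed
qed


section \<open>Quotients of a functional graph and their cuts\<close>

abbreviation fun_quotient :: "'a set \<Rightarrow> ('a \<Rightarrow> 'a) \<Rightarrow> 'a set set \<Rightarrow> ('a set, 'a) pre_digraph" where
  "fun_quotient S g P \<equiv> quotient_graph P \<lparr>verts = S, arcs = S, tail = g, head = id\<rparr>"

text \<open>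
  The functions \<open>f\<close> are the indicator functions of the two sides that remain when the edges
  in \<open>D\<close> are removed from the quotient graph.
\<close>

definition cut_family :: "'a set \<Rightarrow> ('a \<Rightarrow> 'a) \<Rightarrow> ('a \<times> 'a) set \<Rightarrow> 'a set set \<Rightarrow> bool" where
  "cut_family S g r W \<longleftrightarrow>
     (\<forall>D\<in>W. \<exists>f :: 'a \<Rightarrow> bool. (\<forall>(u, v)\<in>r. f u = f v) \<and> (\<forall>u\<in>S. f u \<noteq> f (g u) \<longleftrightarrow> u \<in> D))"

text \<open>The edge with index \<open>x\<close> runs from \<open>g x\<close> to \<open>x\<close>.
  The two disjuncts list the identifications made by the two elements of
  \<open>edge_gluings\<close>, so two edges are parallel iff the partition contains one of their
  gluings.\<close>

definition same_ends :: "('a \<Rightarrow> 'a) \<Rightarrow> ('a \<times> 'a) set \<Rightarrow> 'a \<Rightarrow> 'a \<Rightarrow> bool" where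
  "same_ends g r x y \<longleftrightarrow> (g x, g y) \<in> r \<and> (x, y) \<in> r \<or> (g x, y) \<in> r \<and> (x, g y) \<in> r"

lemma ends_fun_quotient: "ends (fun_quotient S g P) x = {block_of P (g x), block_of P x}"
  by (simp add: ends_def quotient_graph_def)

lemma edge_equiv_fun_quotient:
  assumes "partition_on A P" "S \<subseteq> A" "g ` S \<subseteq> A"
  shows "(x, y) \<in> edge_equiv (fun_quotient S g P) \<longleftrightarrow>
         x \<in> S \<and> y \<in> S \<and> same_ends g (part_rel P) x y"
proof -
  have "ends (fun_quotient S g P) x = ends (fun_quotient S g P) y \<longleftrightarrow>
      same_ends g (part_rel P) x y" if "x \<in> S" "y \<in> S"
  proof -
    have "g x \<in> A" "g y \<in> A" "x \<in> A" "y \<in> A" using assms that by auto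
    then show ?thesis
      by (simp add: ends_fun_quotient same_ends_def doubleton_eq_iff block_of_eq_iff[OF assms(1)])
  qed
  then show ?thesis
    unfolding edge_equiv_def by (auto simp: quotient_graph_def)
qed

lemma equiv_edge_equiv: "equiv (arcs G) (edge_equiv G)"
  unfolding edge_equiv_def by (auto simp: equiv_def refl_on_def sym_def trans_def)

text \<open>Cuts bound a class from above: the cut of \<open>D\<close> changes along
  \<open>x\<close>, hence along every edge with the same ends, and the edges where it changes lie in
  \<open>D\<close>. That the class is not smaller than \<open>D\<close> is the assumption
  \<open>ends\<close>.\<close>

lemma edge_class_eq_cut:
  assumes P: "partition_on A P" and g: "S \<subseteq> A" "g ` S \<subseteq> A"
    and W: "partition_on S W" and cut: "cut_family S g (part_rel P) W"
    and ends: "\<And>D x y. D \<in> W \<Longrightarrow> x \<in> D \<Longrightarrow> y \<in> D \<Longrightarrow> same_ends g (part_rel P) x y"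
    and D: "D \<in> W" "x \<in> D"
  shows "edge_class (fun_quotient S g P) x = D"
proof (intro set_eqI iffI)
  have DS: "D \<subseteq> S" using W D by (auto simp: partition_on_def)
  fix y
  {
    assume "y \<in> D"
    then show "y \<in> edge_class (fun_quotient S g P) x"
      using DS D ends by (auto simp: edge_equiv_fun_quotient[OF P g])
  next
    assume "y \<in> edge_class (fun_quotient S g P) x"
    then have y: "y \<in> S" "same_ends g (part_rel P) x y"
      by (auto simp: edge_equiv_fun_quotient[OF P g])
    obtain f :: "'a \<Rightarrow> bool" where f: "\<forall>(u, v)\<in>part_rel P. f u = f v"
      "\<forall>u\<in>S. f u \<noteq> f (g u) \<longleftrightarrow> u \<in> D"
      using cut D unfolding cut_family_def by blast
    have "f x \<noteq> f (g x)" using f D DS by blast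
    then have "f y \<noteq> f (g y)" using f(1) y(2) by (auto simp: same_ends_def)
    then show "y \<in> D" using f y by blast
  }
qed

lemma edge_classes_eq_cut:
  assumes P: "partition_on A P" and g: "S \<subseteq> A" "g ` S \<subseteq> A"
    and W: "partition_on S W" and cut: "cut_family S g (part_rel P) W"
    and ends: "\<And>D x y. D \<in> W \<Longrightarrow> x \<in> D \<Longrightarrow> y \<in> D \<Longrightarrow> same_ends g (part_rel P) x y"
  shows "S // edge_equiv (fun_quotient S g P) = W"
proof -
  have eq: "edge_class (fun_quotient S g P) x = D" if "D \<in> W" "x \<in> D" for D x
    using edge_class_eq_cut[OF P g W cut ends that] by simp
  have cov: "\<exists>D\<in>W. x \<in> D" if "x \<in> S" for x using W that by (auto simp: partition_on_def)
  show ?thesis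
  proof (intro set_eqI iffI)
    fix D assume "D \<in> S // edge_equiv (fun_quotient S g P)"
    then show "D \<in> W" using eq cov by (metis quotientE)
  next
    fix D assume D: "D \<in> W"
    then obtain x where x: "x \<in> D" using W by (metis partition_onD3 ex_in_conv)
    then have "x \<in> S" using W D by (auto simp: partition_on_def)
    then show "D \<in> S // edge_equiv (fun_quotient S g P)"
      using eq[OF D x] by (metis quotientI)
  qed
qed

section \<open>Cuts exclude cycles, and edges of trees are bridges\<close>

lemma uends_fun_quotient:
  assumes "x \<in> S"
  shows "uends (elementarization (fun_quotient S g P)) (edge_class (fun_quotient S g P) x) =
         {block_of P (g x), block_of P x}"
proof -
  have "x \<in> edge_class (fun_quotient S g P) x"
    using assms by (auto simp: edge_equiv_def quotient_graph_def)
  moreover have "ends (fun_quotient S g P) y = {block_of P (g x), block_of P x}"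
    if "y \<in> edge_class (fun_quotient S g P) x" for y
    using that by (auto simp: edge_equiv_def ends_fun_quotient)
  ultimately show ?thesis unfolding elementarization_def by auto
qed

text \<open>Along a closed walk a two-valued function changes an even number of times, but the cut
  belonging to the first edge of a cycle with distinct edges would change exactly once.\<close>

lemma cut_acyclic:
  assumes P: "partition_on S P" and g: "g ` S \<subseteq> S" and W: "partition_on S W"
    and classes: "S // edge_equiv (fun_quotient S g P) = W"
    and cut: "cut_family S g (part_rel P) W"
  shows "\<not> ucycle (elementarization (fun_quotient S g P)) vs es"
proof
  let ?G = "fun_quotient S g P"
  let ?n = "length vs"
  assume c: "ucycle (elementarization ?G) vs es"
  have n: "0 < ?n" "length es = ?n" and de: "distinct es"
    and esW: "set es \<subseteq> W"
    and ends: "\<And>i. i < ?n \<Longrightarrow> uends (elementarization ?G) (es ! i) = {vs ! i, vs ! (Suc i mod ?n)}"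
    using c classes by (auto simp: ucycle_def elementarization_def quotient_graph_def)
  have nth: "es ! i \<in> W" if "i < ?n" for i using esW n that by auto
  obtain f :: "'a \<Rightarrow> bool" where f: "\<forall>(u, v)\<in>part_rel P. f u = f v"
      "\<forall>u\<in>S. f u \<noteq> f (g u) \<longleftrightarrow> u \<in> es ! 0"
    using cut nth[OF n(1)] unfolding cut_family_def by blast
  \<comment> \<open>The cut is constant on blocks, so it descends to the vertices of the
    quotient.\<close>
  define F where "F B \<longleftrightarrow> (\<exists>x\<in>B. f x)" for B
  have F: "F (block_of P x) = f x" if "x \<in> S" for x
  proof -
    have "f y = f x" if "y \<in> block_of P x" for y
    proof -
      have "(y, x) \<in> part_rel P"
        using block_of_mem[OF P \<open>x \<in> S\<close>] that unfolding part_rel_def by blast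
      then show ?thesis using f(1) by blast
    qed
    then show ?thesis using block_of_mem[OF P \<open>x \<in> S\<close>] unfolding F_def by blast
  qed
  have flip: "F (vs ! i) \<noteq> F (vs ! (Suc i mod ?n)) \<longleftrightarrow> i = 0" if i: "i < ?n" for i
  proof -
    obtain x where x: "x \<in> S" "es ! i = edge_class ?G x"
      using nth[OF i] classes by (metis quotientE)
    then have xi: "x \<in> es ! i" by (auto simp: edge_equiv_def quotient_graph_def)
    have "{vs ! i, vs ! (Suc i mod ?n)} = {block_of P (g x), block_of P x}"
      using ends[OF i] uends_fun_quotient[OF x(1), where g = g and P = P] unfolding x(2) by simp
    then have "F (vs ! i) \<noteq> F (vs ! (Suc i mod ?n)) \<longleftrightarrow>
        F (block_of P x) \<noteq> F (block_of P (g x))"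
      unfolding doubleton_eq_iff by (elim disjE conjE) (simp_all only:, blast?)
    also have "\<dots> \<longleftrightarrow> f x \<noteq> f (g x)"
      using F x(1) g by (simp add: image_subset_iff)
    also have "\<dots> \<longleftrightarrow> x \<in> es ! 0" using f(2) x(1) by blast
    also have "\<dots> \<longleftrightarrow> es ! i = es ! 0"
      using xi disjointD[OF partition_onD2[OF W] nth[OF i] nth[OF n(1)]] by blast
    also have "\<dots> \<longleftrightarrow> i = 0" using de n i by (simp add: nth_eq_iff_index_eq)
    finally show ?thesis .
  qed
  \<comment> \<open>\<open>F\<close> stays constant from the far end of the first edge onwards. For
    \<open>k = ?n - 1\<close> the index returns to 0, the near end of that edge; loops, with
    \<open>?n = 1\<close>, are included.\<close>
  have "F (vs ! (Suc k mod ?n)) = F (vs ! (Suc 0 mod ?n))" if "k < ?n" for k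
    using that
  proof (induction k)
    case (Suc k)
    then show ?case using flip[of "Suc k"] by auto
  qed simp
  from this[of "?n - 1"] flip[of 0] n show False by simp
qed

lemma rtrancl_imp_distinct_walk:
  assumes "(u, v) \<in> R\<^sup>*"
  shows "\<exists>vs. vs \<noteq> [] \<and> hd vs = u \<and> last vs = v \<and> distinct vs \<and> successively (\<lambda>x y. (x, y) \<in> R) vs"
  using assms
proof (induction rule: converse_rtrancl_induct)
  case base
  then show ?case by (intro exI[of _ "[v]"]) auto
next
  case (step u w)
  then obtain vs where vs: "vs \<noteq> []" "hd vs = w" "last vs = v" "distinct vs"
    "successively (\<lambda>x y. (x, y) \<in> R) vs" by blast
  show ?case
  proof (cases "u \<in> set vs")
    case True
    then obtain xs ys where "vs = xs @ u # ys" by (meson split_list)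
    then show ?thesis
      using vs by (intro exI[of _ "u # ys"]) (auto simp: successively_append_iff)
  next
    case False
    then show ?thesis
      using vs step by (intro exI[of _ "u # vs"]) (auto simp: successively_Cons)
  qed
qed

text \<open>A simple walk that avoids \<open>c\<close> and joins the ends of \<open>c\<close> closes
  up with \<open>c\<close> to a cycle. As reachability is reflexive, \<open>u = v\<close> is covered
  too: the walk is one vertex and the cycle a loop.\<close>

lemma tree_edge_is_bridge:
  assumes acyc: "\<nexists>vs es. ucycle G vs es"
    and c: "c \<in> uedges G" "uends G c = {u, v}"
    and sub: "\<And>e. e \<in> uedges G \<Longrightarrow> uends G e \<subseteq> uverts G"
  shows "(u, v) \<notin> {(x, y). \<exists>e\<in>uedges G - {c}. uends G e = {x, y}}\<^sup>*"
proof
  assume "(u, v) \<in> {(x, y). \<exists>e\<in>uedges G - {c}. uends G e = {x, y}}\<^sup>*"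
  then obtain vs where vs: "vs \<noteq> []" "hd vs = u" "last vs = v" "distinct vs"
    and adj: "successively (\<lambda>x y. \<exists>e\<in>uedges G - {c}. uends G e = {x, y}) vs"
    by (drule_tac rtrancl_imp_distinct_walk) auto
  define n where "n = length vs"
  have n: "n > 0" using vs n_def by auto
  have "\<forall>i. Suc i < n \<longrightarrow> (\<exists>e. e \<in> uedges G - {c} \<and> uends G e = {vs ! i, vs ! Suc i})"
    using successively_nth[OF adj] n_def by blast
  then obtain h where h: "\<And>i. Suc i < n \<Longrightarrow> h i \<in> uedges G - {c} \<and> uends G (h i) = {vs ! i, vs ! Suc i}"
    by metis
  define es where "es = map h [0..<n - 1] @ [c]"
  have es_nth: "es ! i = (if i = n - 1 then c else h i)" if "i < n" for i
    using that by (auto simp: es_def nth_append)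
  have len: "length es = n" using n by (simp add: es_def)
  \<comment> \<open>A pair of consecutive vertices determines its position on a simple walk, so the
    edges used at different positions are different.\<close>
  have inj: "i = j" if "Suc i < n" "Suc j < n" "h i = h j" for i j
  proof -
    have "{vs ! i, vs ! Suc i} = {vs ! j, vs ! Suc j}" using h that by metis
    then show ?thesis
      using vs(4) that by (auto simp: doubleton_eq_iff nth_eq_iff_index_eq n_def)
  qed
  have "distinct es"
  proof -
    have "inj_on h (set [0..<n - 1])" using inj by (auto simp: inj_on_def)
    moreover have "c \<notin> h ` set [0..<n - 1]"
    proof
      assume "c \<in> h ` set [0..<n - 1]"
      then obtain i where "i < n - 1" "c = h i" by auto
      then have "Suc i < n" "c = h i" by auto
      then show False using h by blast
    qed
    ultimately show ?thesis by (simp add: es_def distinct_map)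
  qed
  moreover have "set es \<subseteq> uedges G" using h c by (auto simp: es_def)
  moreover have e: "uends G (es ! i) = {vs ! i, vs ! (Suc i mod n)}" if i: "i < n" for i
  proof (cases "i = n - 1")
    case True
    have "vs ! (n - 1) = v" "vs ! 0 = u"
      using vs by (auto simp: n_def last_conv_nth hd_conv_nth)
    then show ?thesis using True c es_nth[OF i] n by auto
  next
    case False
    then show ?thesis using i h es_nth[OF i] by auto
  qed
  moreover have "set vs \<subseteq> uverts G"
  proof
    fix x assume "x \<in> set vs"
    then obtain i where i: "i < n" "x = vs ! i" by (auto simp: in_set_conv_nth n_def)
    then have "x \<in> uends G (es ! i)" using e by auto
    moreover have "es ! i \<in> uedges G" using \<open>set es \<subseteq> uedges G\<close> len i by auto
    ultimately show "x \<in> uverts G" using sub by auto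
  qed
  moreover have "es \<noteq> []" by (simp add: es_def)
  ultimately have "ucycle G vs es"
    using vs len by (auto simp: ucycle_def n_def)
  then show False using acyc by blast
qed

lemma cut_familyE:
  assumes "cut_family S g r W" "D \<in> W"
  obtains f :: "'a \<Rightarrow> bool" where "\<forall>(u, v)\<in>r. f u = f v" "\<forall>u\<in>S. f u \<noteq> f (g u) \<longleftrightarrow> u \<in> D"
  using assms unfolding cut_family_def by blast

text \<open>A cut need only be checked on generators, so it can be given explicitly without any
  knowledge of the blocks.\<close>

lemma cut_family_generated:
  assumes "cut_family S g R W"
  shows "cut_family S g (part_rel (generated_part A R)) W"
  unfolding cut_family_def
proof
  fix D assume "D \<in> W"
  then obtain f :: "'a \<Rightarrow> bool" where f: "\<forall>(u, v)\<in>R. f u = f v" "\<forall>u\<in>S. f u \<noteq> f (g u) \<longleftrightarrow> u \<in> D"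
    by (rule cut_familyE[OF assms])
  have "\<forall>(u, v)\<in>part_rel (generated_part A R). f u = f v"
    using generated_part_respects[OF f(1)] by blast
  then show "\<exists>f :: 'a \<Rightarrow> bool. (\<forall>(u, v)\<in>part_rel (generated_part A R). f u = f v) \<and>
      (\<forall>u\<in>S. f u \<noteq> f (g u) \<longleftrightarrow> u \<in> D)"
    using f(2) by blast
qed


section \<open>Double trees and non-crossing pairings\<close>

text \<open>In contrast to \<open>NC2\<close>, there is no condition outside \<open>S\<close>, so
  that one permutation of all points can be used on each of the three segments.\<close>

definition pairing_on :: "'a set \<Rightarrow> ('a \<Rightarrow> 'a) \<Rightarrow> bool" where
  "pairing_on S p \<longleftrightarrow> (\<forall>x\<in>S. p x \<in> S \<and> p x \<noteq> x \<and> p (p x) = x)"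

definition noncrossing_on :: "nat set \<Rightarrow> (nat \<Rightarrow> nat) \<Rightarrow> bool" where
  "noncrossing_on S p \<longleftrightarrow> \<not> (\<exists>a\<in>S. \<exists>b\<in>S. a < b \<and> b < p a \<and> p a < p b)"

definition pairs :: "'a set \<Rightarrow> ('a \<Rightarrow> 'a) \<Rightarrow> 'a set set" where
  "pairs S p = (\<lambda>x. {x, p x}) ` S"

text \<open>The edge \<open>p x\<close> runs from \<open>g (p x)\<close> to \<open>p x\<close>;
  folding it onto \<open>x\<close> with opposite orientation identifies its tail with the head of
  \<open>x\<close>. For a rotation \<open>g\<close> and a pairing \<open>p\<close> the blocks
  generated in this way are the orbits of \<open>g \<circ> p\<close>: if \<open>p\<close> is
  non-crossing, this is its Kreweras complement up to relabelling.\<close>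

definition pair_rel :: "'a set \<Rightarrow> ('a \<Rightarrow> 'a) \<Rightarrow> ('a \<Rightarrow> 'a) \<Rightarrow> ('a \<times> 'a) set" where
  "pair_rel S g p = (\<lambda>x. (g (p x), x)) ` S"

definition pair_part :: "'a set \<Rightarrow> ('a \<Rightarrow> 'a) \<Rightarrow> ('a \<Rightarrow> 'a) \<Rightarrow> 'a set set" where
  "pair_part S g p = generated_part S (pair_rel S g p)"

lemma pairing_onD: "pairing_on S p \<Longrightarrow> x \<in> S \<Longrightarrow> p x \<in> S \<and> p x \<noteq> x \<and> p (p x) = x"
  by (simp add: pairing_on_def)

lemma partition_on_pairs:
  assumes "pairing_on S p"
  shows "partition_on S (pairs S p)"
proof (rule partition_onI)
  show "\<Union>(pairs S p) = S" using assms by (auto simp: pairs_def pairing_on_def)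
  show "{} \<notin> pairs S p" by (auto simp: pairs_def)
  fix B C assume "B \<in> pairs S p" "C \<in> pairs S p" "B \<noteq> C"
  then obtain x y where "x \<in> S" "y \<in> S" "B = {x, p x}" "C = {y, p y}" by (auto simp: pairs_def)
  moreover have "p x \<in> S" "p y \<in> S" "p (p x) = x" "p (p y) = y"
    using assms calculation by (auto simp: pairing_on_def)
  moreover have False if "x = y \<or> x = p y \<or> p x = y \<or> p x = p y"
    using that \<open>B \<noteq> C\<close> calculation by (metis insert_commute)
  ultimately show "disjnt B C" unfolding disjnt_def by blast
qed

lemma pairs_mem: "x \<in> S \<Longrightarrow> {x, p x} \<in> pairs S p"
  by (simp add: pairs_def)

lemma pair_rel_subset: "pairing_on S p \<Longrightarrow> g ` S \<subseteq> S \<Longrightarrow> pair_rel S g p \<subseteq> S \<times> S"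
  by (auto simp: pair_rel_def pairing_on_def)

lemma same_ends_pairs:
  assumes P: "partition_on A P" "S \<subseteq> A" "g ` S \<subseteq> A" and p: "pairing_on S p"
    and r: "pair_rel S g p \<subseteq> part_rel P" and D: "D \<in> pairs S p" "x \<in> D" "y \<in> D"
  shows "same_ends g (part_rel P) x y"
proof -
  obtain z where z: "z \<in> S" "D = {z, p z}" using D by (auto simp: pairs_def)
  have pz: "p z \<in> S" "p (p z) = z" using p z by (auto simp: pairing_on_def)
  have 1: "(g (p z), z) \<in> part_rel P" using r z by (auto simp: pair_rel_def)
  have "(g (p (p z)), p z) \<in> part_rel P" using r pz(1) unfolding pair_rel_def by blast
  then have 2: "(g z, p z) \<in> part_rel P" using pz by simp
  have refl: "(w, w) \<in> part_rel P" "(g w, g w) \<in> part_rel P" if "w \<in> S" for w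
    using part_rel_refl[OF P(1)] P(2,3) that by auto
  have "x = y \<or> x = z \<and> y = p z \<or> x = p z \<and> y = z" "x \<in> S" using D z pz by auto
  then show ?thesis
    unfolding same_ends_def using 1 2 refl part_rel_sym by metis
qed

text \<open>Multiplicity 2 supplies the partner \<open>p x\<close>, opposite orientation the
  relation \<open>pair_rel\<close>, and the tree property the cuts.\<close>

lemma double_tree_imp_pairing:
  assumes P: "partition_on S P" and g: "g ` S \<subseteq> S" and dt: "double_tree (fun_quotient S g P)"
  obtains p where "pairing_on S p" "pair_rel S g p \<subseteq> part_rel P"
    "\<And>x. x \<in> S \<Longrightarrow> edge_class (fun_quotient S g P) x = {x, p x}"
    "cut_family S g (part_rel P) (pairs S p)"
proof -
  let ?G = "fun_quotient S g P"
  let ?T = "elementarization ?G"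
  have edges: "uedges ?T = S // edge_equiv ?G" "uverts ?T = P"
    by (auto simp: elementarization_def quotient_graph_def)
  have class_edge: "edge_class ?G x \<in> uedges ?T" "x \<in> edge_class ?G x" if "x \<in> S" for x
    using that quotientI[OF that, of "edge_equiv ?G"] unfolding edges(1)
    by (simp_all add: edge_equiv_def quotient_graph_def)
  have class_sub: "edge_class ?G x \<subseteq> S" for x
    by (auto simp: edge_equiv_def quotient_graph_def)
  have "\<exists>y. y \<noteq> x \<and> edge_class ?G x = {x, y} \<and> (g y, x) \<in> part_rel P" if x: "x \<in> S" for x
  proof -
    have "card (edge_class ?G x) = 2"
      using dt class_edge(1)[OF x] unfolding double_tree_def by blast
    then obtain u v where "edge_class ?G x = {u, v}" "u \<noteq> v"
      unfolding card_2_iff by blast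
    moreover from this have "x = u \<or> x = v" using class_edge(2)[OF x] by simp
    ultimately obtain y where y: "y \<noteq> x" "edge_class ?G x = {x, y}"
      by (metis insert_commute)
    then have "y \<in> S" using class_sub[of x] by auto
    have "\<forall>e\<in>edge_class ?G x. \<forall>f\<in>edge_class ?G x. e \<noteq> f \<longrightarrow> tail ?G e = head ?G f"
      using dt class_edge(1)[OF x] unfolding double_tree_def by blast
    then have "tail ?G y = head ?G x"
      using y class_edge(2)[OF x] by simp
    then have "block_of P (g y) = block_of P x" by (simp add: quotient_graph_def)
    then have "(g y, x) \<in> part_rel P"
      using block_of_eq_iff[OF P] g x \<open>y \<in> S\<close> by auto
    with y show ?thesis by blast
  qed
  then obtain p where p: "\<And>x. x \<in> S \<Longrightarrow> p x \<noteq> x"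
    "\<And>x. x \<in> S \<Longrightarrow> edge_class ?G x = {x, p x}" "\<And>x. x \<in> S \<Longrightarrow> (g (p x), x) \<in> part_rel P"
    by metis
  have pS: "p x \<in> S" if "x \<in> S" for x using class_sub[of x] p(2)[OF that] by auto
  have pp: "p (p x) = x" if x: "x \<in> S" for x
  proof -
    have "(x, p x) \<in> edge_equiv ?G" using p(2)[OF x] by auto
    then have "edge_class ?G x = edge_class ?G (p x)"
      by (rule equiv_class_eq[OF equiv_edge_equiv])
    then have "{x, p x} = {p x, p (p x)}" using p(2)[OF x] p(2)[OF pS[OF x]] by simp
    then show ?thesis using p(1)[OF x] by (auto simp: doubleton_eq_iff)
  qed
  have pair: "pairing_on S p" using p(1) pS pp by (simp add: pairing_on_def)
  have acyc: "\<nexists>vs es. ucycle ?T vs es" using dt by (simp add: double_tree_def utree_def)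
  have uends: "uends ?T {x, p x} = {block_of P (g x), block_of P x}" if "x \<in> S" for x
    using uends_fun_quotient[OF that, where g = g and P = P] p(2)[OF that] by simp
  have cut: "cut_family S g (part_rel P) (pairs S p)"
    unfolding cut_family_def
  proof
    fix D assume "D \<in> pairs S p"
    then obtain x where x: "x \<in> S" "D = {x, p x}" by (auto simp: pairs_def)
    have DT: "D \<in> uedges ?T" using class_edge[OF x(1)] p(2)[OF x(1)] x by simp
    define R where "R = {(u, v). \<exists>e\<in>uedges ?T - {D}. uends ?T e = {u, v}}"
    have symR: "sym (R\<^sup>*)" unfolding R_def by (intro sym_rtrancl) (auto simp: sym_def insert_commute)
    have sub: "uends ?T e \<subseteq> uverts ?T" if e: "e \<in> uedges ?T" for e
    proof -
      obtain y where y: "y \<in> S" "e = edge_class ?G y" using e unfolding edges by (rule quotientE)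
      have "uends ?T e = {block_of P (g y), block_of P y}"
        using uends_fun_quotient[OF y(1)] y(2) by simp
      then show ?thesis using block_of_mem[OF P] y(1) g unfolding edges by auto
    qed
    have bridge: "(block_of P x, block_of P (g x)) \<notin> R\<^sup>*"
      unfolding R_def
    proof (rule tree_edge_is_bridge[OF acyc DT _ sub])
      show "uends ?T D = {block_of P x, block_of P (g x)}"
        using uends[OF x(1)] unfolding x(2) by (simp add: insert_commute)
    qed
    \<comment> \<open>This selects the vertices still connected to that of \<open>x\<close> once the
      class \<open>D\<close> is removed.\<close>
    define f where "f z \<longleftrightarrow> (block_of P x, block_of P z) \<in> R\<^sup>*" for z
    have resp: "f u = f v" if "(u, v) \<in> part_rel P" for u v
    proof -
      have "u \<in> S" "v \<in> S" using part_rel_mem[OF P that] by auto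
      then have "block_of P u = block_of P v" using block_of_eq_iff[OF P] that by blast
      then show ?thesis by (simp add: f_def)
    qed
    have "f x \<noteq> f (g x)" using bridge by (simp add: f_def)
    have flip: "f u \<noteq> f (g u) \<longleftrightarrow> u \<in> D" if u: "u \<in> S" for u
    proof (cases "u \<in> D")
      case True
      have "same_ends g (part_rel P) u x"
        by (rule same_ends_pairs[OF P subset_refl g pair _ \<open>D \<in> pairs S p\<close> True])
          (use p(3) x in \<open>auto simp: pair_rel_def\<close>)
      then have "f u \<noteq> f (g u)"
        using \<open>f x \<noteq> f (g x)\<close> resp unfolding same_ends_def by metis
      then show ?thesis using True by simp
    next
      case False
      have "{u, p u} \<in> uedges ?T - {D}"
        using False class_edge(1)[OF u] p(2)[OF u] by auto
      then have "(block_of P u, block_of P (g u)) \<in> R" "(block_of P (g u), block_of P u) \<in> R"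
        unfolding R_def using uends[OF u] by (auto simp: insert_commute)
      then have "f u = f (g u)" unfolding f_def by (meson rtrancl.rtrancl_into_rtrancl)
      then show ?thesis using False by simp
    qed
    show "\<exists>f :: 'a \<Rightarrow> bool. (\<forall>(u, v)\<in>part_rel P. f u = f v) \<and> (\<forall>u\<in>S. f u \<noteq> f (g u) \<longleftrightarrow> u \<in> D)"
      using resp flip by (intro exI[of _ f]) auto
  qed
  show thesis
    by (rule that[OF pair _ p(2) cut]) (use p(3) in \<open>auto simp: pair_rel_def\<close>)
qed

section \<open>Pairings of an interval with cyclic successor\<close>

lemma constant_between:
  assumes "s \<le> t" "\<And>u. s \<le> u \<Longrightarrow> u < t \<Longrightarrow> f u = f (Suc u)"
  shows "f s = f t"
  using assms by (induction rule: dec_induct) auto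

text \<open>This isolates the behaviour of \<open>\<gamma>\<close> on one segment. Except at
  \<open>b\<close>, the map is the successor, so that statements on the walk become statements on
  intervals of \<open>nat\<close>.\<close>

locale rotation =
  fixes a b :: nat and g :: "nat \<Rightarrow> nat"
  assumes le: "a \<le> b"
    and g: "x \<in> {a..b} \<Longrightarrow> g x = (if x = b then a else Suc x)"
begin

lemma g_image: "g ` {a..b} \<subseteq> {a..b}"
  using le by (auto simp: g)

text \<open>The chord from \<open>x\<close> to \<open>p x\<close> cuts off an arc of the cycle, and
  the indicator of this arc is the cut. As \<open>p\<close> is non-crossing, chords starting
  strictly inside the arc end there, which makes the indicator compatible with
  \<open>pair_rel\<close>.\<close>

lemma noncrossing_imp_cut:
  assumes p: "pairing_on {a..b} p" and nc: "noncrossing_on {a..b} p"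
  shows "cut_family {a..b} g (pair_rel {a..b} g p) (pairs {a..b} p)"
  unfolding cut_family_def
proof
  let ?S = "{a..b}"
  note pD = pairing_onD[OF p]
  fix D assume "D \<in> pairs ?S p"
  then obtain y where y: "y \<in> ?S" "D = {y, p y}" by (auto simp: pairs_def)
  obtain x where x: "x \<in> ?S" "x < p x" "D = {x, p x}"
  proof (cases "y < p y")
    case True
    then show ?thesis using y that by blast
  next
    case False
    then have "p y < p (p y)" using pD[OF y(1)] by auto
    then show ?thesis using y pD[OF y(1)] by (intro that[of "p y"]) auto
  qed
  have px: "p x \<in> ?S" "p (p x) = x" using pD[OF x(1)] by auto
  \<comment> \<open>Half-open, because the step from \<open>u\<close> to \<open>Suc u\<close> then
    changes membership exactly at \<open>u = x\<close> and \<open>u = p x\<close>.\<close>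
  define f where "f u \<longleftrightarrow> x < u \<and> u \<le> p x" for u
  \<comment> \<open>This includes \<open>w = b\<close>: there \<open>g w = a \<le> x\<close> and
    \<open>p x \<le> b\<close>, so both sides are false.\<close>
  have fg: "f (g w) \<longleftrightarrow> x \<le> w \<and> w < p x" if "w \<in> ?S" for w
    using that x px unfolding f_def g[OF that] by auto
  \<comment> \<open>Leaving to the right would give the crossing \<open>x < u < p x < p u\<close>,
    leaving to the left \<open>p u < x < u < p x\<close>.\<close>
  have inside: "x < p u \<and> p u < p x" if u: "u \<in> ?S" "x < u" "u < p x" for u
  proof -
    have pu: "p u \<in> ?S" "p (p u) = u" "p u \<noteq> u" using pD[OF u(1)] by auto
    have "\<not> p x < p u" using nc u x unfolding noncrossing_on_def by blast
    moreover have "p u \<noteq> p x" using pu(2) px(2) u(2) by (metis less_irrefl)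
    moreover have "p u \<noteq> x" using pu(2) u by auto
    moreover have "\<not> p u < x"
      using nc pu u x(1) unfolding noncrossing_on_def by metis
    ultimately show ?thesis by auto
  qed
  have "f (g (p u)) = f u" if u: "u \<in> ?S" for u
  proof -
    have pu: "p u \<in> ?S" "p (p u) = u" using pD[OF u] by auto
    show ?thesis
    proof (cases "u = x \<or> u = p x")
      case True
      then show ?thesis using fg[OF pu(1)] px x unfolding f_def by auto
    next
      case False
      then have "p u \<noteq> x" "p u \<noteq> p x" using pu px by metis+
      then show ?thesis
        using False inside[OF u] inside[OF pu(1)] pu fg[OF pu(1)] unfolding f_def by fastforce
    qed
  qed
  moreover have "f u \<noteq> f (g u) \<longleftrightarrow> u \<in> D" if "u \<in> ?S" for u
    using fg[OF that] x(2) unfolding f_def x(3) by auto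
  ultimately show "\<exists>f :: nat \<Rightarrow> bool. (\<forall>(u, v)\<in>pair_rel ?S g p. f u = f v) \<and>
      (\<forall>u\<in>?S. f u \<noteq> f (g u) \<longleftrightarrow> u \<in> D)"
    by (intro exI[of _ f]) (auto simp: pair_rel_def)
qed

text \<open>
  The walk from \<open>x\<close> to \<open>y\<close> must traverse the edge \<open>x\<close> back, by the cut at \<open>x\<close>, and it
  does so at \<open>p x\<close>; the remaining walk is shorter.
\<close>

lemma cuts_separate:
  assumes p: "pairing_on {a..b} p" and E: "equiv {a..b} E" and pE: "pair_rel {a..b} g p \<subseteq> E"
    and xy: "x \<in> {a..b}" "y \<in> {a..b}" "x \<le> y"
    and cut: "\<And>z. z \<in> {a..b} \<Longrightarrow> \<exists>f :: nat \<Rightarrow> bool. (\<forall>(u, v)\<in>E. f u = f v) \<and>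
        (\<forall>u\<in>{a..b}. f u \<noteq> f (g u) \<longleftrightarrow> u \<in> {z, p z}) \<and> f x = f y"
  shows "(x, y) \<in> E"
  using xy cut
proof (induction "y - x" arbitrary: x rule: less_induct)
  case less
  let ?S = "{a..b}"
  show ?case
  proof (cases "x = y")
    case True
    then show ?thesis using E less.prems by (simp add: equiv_def refl_on_def)
  next
    case False
    then have xy: "x < y" using less.prems by simp
    obtain f :: "nat \<Rightarrow> bool" where f: "\<forall>u\<in>?S. f u \<noteq> f (g u) \<longleftrightarrow> u \<in> {x, p x}" "f x = f y"
      using less.prems(4)[OF less.prems(1)] by (elim exE conjE) (rule that)
    have flip: "f u \<noteq> f (Suc u) \<longleftrightarrow> u \<in> {x, p x}" if "x \<le> u" "u < y" for u
    proof -
      have "u \<in> ?S" "g u = Suc u" using g[of u] that less.prems(1,2) by auto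
      then show ?thesis using bspec[OF f(1), of u] by simp
    qed
    \<comment> \<open>Otherwise \<open>x\<close> is the only point from \<open>x\<close> up to
      \<open>y - 1\<close> at which the cut of \<open>{x, p x}\<close> changes, contrary to
      \<open>f x = f y\<close>.\<close>
    have "x < p x \<and> p x < y"
    proof (rule ccontr)
      assume "\<not> ?thesis"
      then have "u \<notin> {x, p x}" if "Suc x \<le> u" "u < y" for u
        using that by (auto simp: Suc_le_eq)
      then have step: "f u = f (Suc u)" if "Suc x \<le> u" "u < y" for u
        using flip[of u] that by (meson Suc_leD)
      have "f (Suc x) = f y"
        by (rule constant_between[of "Suc x" y f, OF Suc_leI[OF xy] step])
      then show False using f(2) flip[of x] xy by simp
    qed
    then have px: "x < p x" "p x < y" by auto
    have pS: "p x \<in> ?S" "p (p x) = x" "g (p x) = Suc (p x)"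
      using px less.prems(1,2) pairing_onD[OF p less.prems(1)] g[of "p x"] by auto
    have xE: "(x, Suc (p x)) \<in> E"
    proof -
      have "(g (p x), x) \<in> pair_rel ?S g p"
        using less.prems(1) by (simp add: pair_rel_def)
      then have "(Suc (p x), x) \<in> E" using pE pS(3) by auto
      then show ?thesis using E by (meson equiv_def symD)
    qed
    \<comment> \<open>\<open>Suc (p x)\<close> is equivalent to \<open>x\<close>, so the same cuts
      take equal values at it and at \<open>y\<close>, and the distance to \<open>y\<close> has
      dropped.\<close>
    have "(Suc (p x), y) \<in> E"
    proof (rule less.hyps)
      fix z assume "z \<in> ?S"
      obtain f :: "nat \<Rightarrow> bool" where f: "\<forall>(u, v)\<in>E. f u = f v"
        "\<forall>u\<in>?S. f u \<noteq> f (g u) \<longleftrightarrow> u \<in> {z, p z}" "f x = f y"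
        using less.prems(4)[OF \<open>z \<in> ?S\<close>] by (elim exE conjE) (rule that)
      have "f (Suc (p x)) = f y" using f xE by auto
      then show "\<exists>f :: nat \<Rightarrow> bool. (\<forall>(u, v)\<in>E. f u = f v) \<and>
        (\<forall>u\<in>?S. f u \<noteq> f (g u) \<longleftrightarrow> u \<in> {z, p z}) \<and> f (Suc (p x)) = f y" using f(1,2) by (intro exI[of _ f] conjI)
    qed (use px less.prems in auto)
    then show ?thesis using xE E by (auto simp: equiv_def elim: transE)
  qed
qed

text \<open>For a crossing \<open>c < d < p c < p d\<close>, the cut of \<open>{c, p c}\<close>
  changes only at \<open>p c\<close> on the way from \<open>Suc d\<close> to \<open>p d\<close>,
  although \<open>pair_rel\<close> identifies these two points.\<close>

lemma cut_imp_noncrossing: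
  assumes P: "partition_on {a..b} P" and p: "pairing_on {a..b} p"
    and r: "pair_rel {a..b} g p \<subseteq> part_rel P"
    and cut: "cut_family {a..b} g (part_rel P) (pairs {a..b} p)"
  shows "noncrossing_on {a..b} p"
  unfolding noncrossing_on_def
proof clarify
  let ?S = "{a..b}"
  fix c d assume cd: "c \<in> ?S" "d \<in> ?S" "c < d" "d < p c" "p c < p d"
  have pcd: "p c \<in> ?S" "p d \<in> ?S" "p (p d) = d" using pairing_onD[OF p] cd by auto
  obtain f :: "nat \<Rightarrow> bool" where f: "\<forall>(u, v)\<in>part_rel P. f u = f v"
    "\<forall>u\<in>?S. f u \<noteq> f (g u) \<longleftrightarrow> u \<in> {c, p c}"
    by (rule cut_familyE[OF cut pairs_mem[OF cd(1)]])
  have flip: "f u \<noteq> f (Suc u) \<longleftrightarrow> u \<in> {c, p c}" if "u \<in> ?S" "u < b" for u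
    using bspec[OF f(2) that(1)] g[OF that(1)] that(2) by simp
  have "f u = f (Suc u)" if "Suc d \<le> u" "u < p c" for u
    using flip[of u] cd pcd that by simp
  then have "f (Suc d) = f (p c)"
    by (rule constant_between[rotated]) (use cd in auto)
  moreover have "f (p c) \<noteq> f (Suc (p c))"
    using flip[of "p c"] cd pcd by auto
  moreover have "f u = f (Suc u)" if "Suc (p c) \<le> u" "u < p d" for u
    using flip[of u] cd pcd that by simp
  then have "f (Suc (p c)) = f (p d)"
    by (rule constant_between[rotated]) (use cd in auto)
  moreover have "(g (p (p d)), p d) \<in> part_rel P"
    using r pcd(2) unfolding pair_rel_def by blast
  moreover have "g (p (p d)) = Suc d" using pcd g[of d] cd by auto
  ultimately show False using f(1) by auto
qed

text \<open>Two points in one block of \<open>P\<close> are separated by no cut of \<open>P\<close>,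
  and \<open>cuts_separate\<close> turns this into an identification generated by
  \<open>pair_rel\<close>.\<close>

lemma cut_imp_pair_part:
  assumes P: "partition_on {a..b} P" and p: "pairing_on {a..b} p"
    and r: "pair_rel {a..b} g p \<subseteq> part_rel P"
    and cut: "cut_family {a..b} g (part_rel P) (pairs {a..b} p)"
  shows "P = pair_part {a..b} g p"
proof -
  let ?S = "{a..b}" and ?Q = "pair_part {a..b} g p"
  have Q: "partition_on ?S ?Q" unfolding pair_part_def by (rule partition_on_generated)
  have QP: "part_rel ?Q \<subseteq> part_rel P"
    unfolding pair_part_def by (rule generated_part_least[OF P r])
  have rQ: "pair_rel ?S g p \<subseteq> part_rel ?Q"
    unfolding pair_part_def using pair_rel_subset[OF p g_image] by (rule generated_part_superset)
  have le: "(x, y) \<in> part_rel ?Q" if "(x, y) \<in> part_rel P" "x \<le> y" for x y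
  proof (rule cuts_separate[OF p equiv_part_rel[OF Q] rQ _ _ that(2)])
    show "x \<in> ?S" "y \<in> ?S" using part_rel_mem[OF P that(1)] by auto
    fix z assume "z \<in> ?S"
    obtain f :: "nat \<Rightarrow> bool" where "\<forall>(u, v)\<in>part_rel P. f u = f v"
      "\<forall>u\<in>?S. f u \<noteq> f (g u) \<longleftrightarrow> u \<in> {z, p z}"
      by (rule cut_familyE[OF cut pairs_mem[OF \<open>z \<in> ?S\<close>]])
    then show "\<exists>f :: nat \<Rightarrow> bool. (\<forall>(u, v)\<in>part_rel ?Q. f u = f v) \<and>
        (\<forall>u\<in>?S. f u \<noteq> f (g u) \<longleftrightarrow> u \<in> {z, p z}) \<and> f x = f y"
      using QP that(1) by (intro exI[of _ f]) auto
  qed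
  have "(x, y) \<in> part_rel ?Q" if "(x, y) \<in> part_rel P" for x y
    using le[of x y] le[of y x] that part_rel_sym[of _ _ P] part_rel_sym[of _ _ ?Q]
    by (meson nle_le)
  then show ?thesis using QP by (intro part_rel_inject[OF P Q]) auto
qed

text \<open>The quotient is connected because, for \<open>n < b\<close>, the edge with index
  \<open>n\<close> joins the blocks of \<open>n\<close> and \<open>Suc n\<close>; it has no cycles
  by \<open>cut_acyclic\<close>.\<close>

lemma cut_imp_double_tree:
  assumes P: "partition_on {a..b} P" and p: "pairing_on {a..b} p"
    and r: "pair_rel {a..b} g p \<subseteq> part_rel P"
    and cut: "cut_family {a..b} g (part_rel P) (pairs {a..b} p)"
  shows "double_tree (fun_quotient {a..b} g P)"
    and "x \<in> {a..b} \<Longrightarrow> edge_class (fun_quotient {a..b} g P) x = {x, p x}"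
proof -
  let ?S = "{a..b}" and ?G = "fun_quotient {a..b} g P"
  let ?T = "elementarization ?G"
  note pp = partition_on_pairs[OF p]
  note se = same_ends_pairs[OF P subset_refl g_image p r]
  have classes: "?S // edge_equiv ?G = pairs ?S p"
    by (rule edge_classes_eq_cut[OF P subset_refl g_image pp cut se])
  show cl: "edge_class ?G x = {x, p x}" if "x \<in> ?S" for x
    by (rule edge_class_eq_cut[OF P subset_refl g_image pp cut se])
      (use that in \<open>auto simp: pairs_def\<close>)
  have edges: "uedges ?T = pairs ?S p" "uverts ?T = P"
    using classes by (auto simp: elementarization_def quotient_graph_def)
  have step: "(block_of P x, block_of P (g x)) \<in> uadj ?T" if "x \<in> ?S" for x
  proof -
    have "uends ?T {x, p x} = {block_of P (g x), block_of P x}"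
      using uends_fun_quotient[OF that, where g = g and P = P] cl[OF that] by simp
    then show ?thesis
      using pairs_mem[OF that, of p] unfolding edges(1)[symmetric] uadj_def
      by (auto simp: insert_commute intro!: bexI[of _ "{x, p x}"])
  qed
  have sym: "sym ((uadj ?T)\<^sup>*)"
    by (intro sym_rtrancl) (auto simp: sym_def uadj_def insert_commute)
  have reach: "(block_of P a, block_of P x) \<in> (uadj ?T)\<^sup>*" if "x \<in> ?S" for x
  proof -
    have "a \<le> x" using that by simp
    then show ?thesis using that
    proof (induction x rule: dec_induct)
      case (step n)
      then have "(block_of P n, block_of P (Suc n)) \<in> uadj ?T"
        using \<open>\<And>x. x \<in> ?S \<Longrightarrow> (block_of P x, block_of P (g x)) \<in> uadj ?T\<close>[of n] g[of n] by auto
      moreover have "(block_of P a, block_of P n) \<in> (uadj ?T)\<^sup>*"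
        by (rule step.IH) (use step.hyps step.prems in auto)
      ultimately show ?case by (rule rtrancl_into_rtrancl[rotated])
    qed simp
  qed
  have conn: "uconnected ?T"
    unfolding uconnected_def edges
  proof (intro conjI ballI)
    show "P \<noteq> {}" using P le by (auto simp: partition_on_def)
    fix B C assume "B \<in> P" "C \<in> P"
    then obtain x y where xy: "x \<in> B" "y \<in> C" using P by (metis partition_onD3 ex_in_conv)
    then have "x \<in> ?S" "y \<in> ?S" using P \<open>B \<in> P\<close> \<open>C \<in> P\<close> by (auto simp: partition_on_def)
    moreover have "B = block_of P x" "C = block_of P y"
      using block_of_eqI[OF P] xy \<open>B \<in> P\<close> \<open>C \<in> P\<close> by auto
    ultimately show "(B, C) \<in> (uadj ?T)\<^sup>*"
      using reach sym by (metis rtrancl_trans symD)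
  qed
  have "utree ?T"
    using conn cut_acyclic[OF P g_image pp classes cut] by (simp add: utree_def)
  moreover have "card c = 2 \<and> (\<forall>e\<in>c. \<forall>f\<in>c. e \<noteq> f \<longrightarrow> tail ?G e = head ?G f \<and> head ?G e = tail ?G f)"
    if c: "c \<in> uedges ?T" for c
  proof -
    obtain x where x: "x \<in> ?S" "c = {x, p x}" using c unfolding edges(1) pairs_def by blast
    have px: "p x \<in> ?S" "p x \<noteq> x" "p (p x) = x" using pairing_onD[OF p x(1)] by auto
    have 1: "(g (p x), x) \<in> part_rel P" "(g (p (p x)), p x) \<in> part_rel P"
      using r x(1) px(1) unfolding pair_rel_def by blast+
    have "block_of P (g (p x)) = block_of P x" "block_of P (g x) = block_of P (p x)"
      using 1 px(3) x(1) px(1) part_rel_mem[OF P] block_of_eq_iff[OF P] by auto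
    then show ?thesis using x(2) px(2) by (auto simp: quotient_graph_def)
  qed
  ultimately show "double_tree ?G" unfolding double_tree_def by blast
qed

end


section \<open>Gluing cut families\<close>

lemma partition_on_glue:
  assumes W: "partition_on S1 W1" "partition_on S2 W2" and dis: "S1 \<inter> S2 = {}"
    and D: "D1 \<in> W1" "D2 \<in> W2"
  shows "partition_on (S1 \<union> S2) (W1 - {D1} \<union> (W2 - {D2}) \<union> {D1 \<union> D2})"
proof (rule partition_onI)
  show "\<Union>(W1 - {D1} \<union> (W2 - {D2}) \<union> {D1 \<union> D2}) = S1 \<union> S2"
    using W D by (auto simp: partition_on_def)
  show "{} \<notin> W1 - {D1} \<union> (W2 - {D2}) \<union> {D1 \<union> D2}"
    using W D by (auto simp: partition_on_def)
  have sub: "B \<subseteq> S1" if "B \<in> W1" for B using W that by (auto simp: partition_on_def)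
  have sub2: "B \<subseteq> S2" if "B \<in> W2" for B using W that by (auto simp: partition_on_def)
  have d1: "disjnt B C" if "B \<in> W1" "C \<in> W1" "B \<noteq> C" for B C
    using partition_onD2[OF W(1)] that by (auto simp: disjoint_def disjnt_def)
  have d2: "disjnt B C" if "B \<in> W2" "C \<in> W2" "B \<noteq> C" for B C
    using partition_onD2[OF W(2)] that by (auto simp: disjoint_def disjnt_def)
  have d12: "disjnt B C" "disjnt C B" if "B \<in> W1" "C \<in> W2" for B C
    using sub[OF that(1)] sub2[OF that(2)] dis by (auto simp: disjnt_def)
  have old: "disjnt B C" if "B \<in> W1 \<union> W2" "C \<in> W1 \<union> W2" "B \<noteq> C" for B C
  proof -
    from that(1,2) consider "B \<in> W1" "C \<in> W1" | "B \<in> W2" "C \<in> W2" | "B \<in> W1" "C \<in> W2" | "B \<in> W2" "C \<in> W1"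
      by auto
    then show ?thesis by cases (simp_all add: d1 d2 d12 that(3))
  qed
  have new: "disjnt B (D1 \<union> D2)" if "B \<in> W1 - {D1} \<union> (W2 - {D2})" for B
    unfolding disjnt_Un2 using that
  proof (elim UnE DiffE)
    assume "B \<in> W1" "B \<notin> {D1}"
    then show "disjnt B D1 \<and> disjnt B D2" using d1 d12 D by simp
  next
    assume "B \<in> W2" "B \<notin> {D2}"
    then show "disjnt B D1 \<and> disjnt B D2" using d2 d12 D by simp
  qed
  fix B C
  assume "B \<in> W1 - {D1} \<union> (W2 - {D2}) \<union> {D1 \<union> D2}" "C \<in> W1 - {D1} \<union> (W2 - {D2}) \<union> {D1 \<union> D2}" "B \<noteq> C"
  then show "disjnt B C"
    using old new disjnt_sym by blast
qed

text \<open>Stated for arbitrary relations and families rather than for trees, so that it can be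
  applied twice: the third tree is glued to the result of the first gluing.\<close>

lemma cut_family_glue:
  assumes dis: "S1 \<inter> S2 = {}" and g: "g ` S1 \<subseteq> S1" "g ` S2 \<subseteq> S2"
    and r: "r1 \<subseteq> S1 \<times> S1" "r2 \<subseteq> S2 \<times> S2"
    and cut: "cut_family S1 g r1 W1" "cut_family S2 g r2 W2"
    and W: "partition_on S1 W1" "partition_on S2 W2"
    and D: "D1 \<in> W1" "e \<in> D1" "D2 \<in> W2" "h \<in> D2"
    and gl: "gl = {(g e, g h), (e, h)} \<or> gl = {(g e, h), (e, g h)}"
  shows "cut_family (S1 \<union> S2) g (r1 \<union> r2 \<union> gl) (W1 - {D1} \<union> (W2 - {D2}) \<union> {D1 \<union> D2})"
  unfolding cut_family_def
proof
  have eh: "e \<in> S1" "h \<in> S2" using D W by (auto simp: partition_on_def)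
  then have geh: "g e \<in> S1" "g h \<in> S2" using g by auto
  note mem = eh geh
  have not1: "u \<notin> S1" if "u \<in> S2" for u using dis that by auto
  have gS1: "g u \<in> S1" if "u \<in> S1" for u using g that by auto
  have gS2: "g u \<in> S2" if "u \<in> S2" for u using g that by auto
  fix D assume "D \<in> W1 - {D1} \<union> (W2 - {D2}) \<union> {D1 \<union> D2}"
  then consider "D \<in> W1" "D \<noteq> D1" | "D \<in> W2" "D \<noteq> D2" | "D = D1 \<union> D2" by auto
  then show "\<exists>f :: 'a \<Rightarrow> bool. (\<forall>(u, v)\<in>r1 \<union> r2 \<union> gl. f u = f v) \<and>
      (\<forall>u\<in>S1 \<union> S2. f u \<noteq> f (g u) \<longleftrightarrow> u \<in> D)"
  proof cases
    case 1
    obtain f :: "'a \<Rightarrow> bool" where f: "\<forall>(u, v)\<in>r1. f u = f v" "\<forall>u\<in>S1. f u \<noteq> f (g u) \<longleftrightarrow> u \<in> D"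
      by (rule cut_familyE[OF cut(1) \<open>D \<in> W1\<close>])
    have "e \<notin> D" using disjointD[OF partition_onD2[OF W(1)] 1(1) D(1) 1(2)] D(2) by blast
    \<comment> \<open>The cut does not change along the glued edge, so its value there can serve as
      the constant on \<open>S2\<close>.\<close>
    then have fe: "f (g e) = f e" using f eh by auto
    have "D \<subseteq> S1" using 1 W(1) by (auto simp: partition_on_def)
    define f' where "f' u = (if u \<in> S1 then f u else f e)" for u
    have "f' u = f' v" if "(u, v) \<in> r1 \<union> r2 \<union> gl" for u v
    proof -
      have "f' u = f' v" if uv: "(u, v) \<in> r1"
      proof -
        have "u \<in> S1" "v \<in> S1" "f u = f v" using f(1) r(1) uv by auto
        then show ?thesis by (simp add: f'_def)
      qed
      moreover have "f' u = f' v" if "(u, v) \<in> r2"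
        using r(2) that not1 unfolding f'_def by auto
      moreover have "f' u = f' v" if "(u, v) \<in> gl"
        using gl that mem not1 fe unfolding f'_def by auto
      ultimately show ?thesis using that by blast
    qed
    moreover have "f' u \<noteq> f' (g u) \<longleftrightarrow> u \<in> D" if "u \<in> S1 \<union> S2" for u
    proof (cases "u \<in> S1")
      case True
      then show ?thesis using f(2) gS1 unfolding f'_def by simp
    next
      case False
      then have "u \<in> S2" using that by simp
      then show ?thesis using not1 gS2 False \<open>D \<subseteq> S1\<close> unfolding f'_def by auto
    qed
    ultimately show ?thesis by (intro exI[of _ f']) auto
  next
    case 2
    obtain f :: "'a \<Rightarrow> bool" where f: "\<forall>(u, v)\<in>r2. f u = f v" "\<forall>u\<in>S2. f u \<noteq> f (g u) \<longleftrightarrow> u \<in> D"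
      by (rule cut_familyE[OF cut(2) \<open>D \<in> W2\<close>])
    have "h \<notin> D" using disjointD[OF partition_onD2[OF W(2)] 2(1) D(3) 2(2)] D(4) by blast
    then have fh: "f (g h) = f h" using f eh by auto
    have "D \<subseteq> S2" using 2 W(2) by (auto simp: partition_on_def)
    define f' where "f' u = (if u \<in> S1 then f h else f u)" for u
    have "f' u = f' v" if "(u, v) \<in> r1 \<union> r2 \<union> gl" for u v
    proof -
      have "f' u = f' v" if uv: "(u, v) \<in> r2"
      proof -
        have "u \<notin> S1" "v \<notin> S1" "f u = f v" using f(1) r(2) uv not1 by auto
        then show ?thesis by (simp add: f'_def)
      qed
      moreover have "f' u = f' v" if "(u, v) \<in> r1"
        using r(1) that unfolding f'_def by auto
      moreover have "f' u = f' v" if "(u, v) \<in> gl"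
        using gl that mem not1 fh unfolding f'_def by auto
      ultimately show ?thesis using that by blast
    qed
    moreover have "f' u \<noteq> f' (g u) \<longleftrightarrow> u \<in> D" if "u \<in> S1 \<union> S2" for u
    proof (cases "u \<in> S1")
      case True
      then show ?thesis using gS1 not1 \<open>D \<subseteq> S2\<close> unfolding f'_def by auto
    next
      case False
      then have "u \<in> S2" using that by simp
      then show ?thesis using f(2) not1 gS2 unfolding f'_def by simp
    qed
    ultimately show ?thesis by (intro exI[of _ f']) auto
  next
    case 3
    obtain f1 :: "'a \<Rightarrow> bool" where f1: "\<forall>(u, v)\<in>r1. f1 u = f1 v" "\<forall>u\<in>S1. f1 u \<noteq> f1 (g u) \<longleftrightarrow> u \<in> D1"
      by (rule cut_familyE[OF cut(1) D(1)])
    obtain f2 :: "'a \<Rightarrow> bool" where f2: "\<forall>(u, v)\<in>r2. f2 u = f2 v" "\<forall>u\<in>S2. f2 u \<noteq> f2 (g u) \<longleftrightarrow> u \<in> D2"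
      by (rule cut_familyE[OF cut(2) D(3)])
    have fe: "f1 (g e) \<longleftrightarrow> \<not> f1 e" and fh: "f2 (g h) \<longleftrightarrow> \<not> f2 h"
      using f1(2) f2(2) eh D by blast+
    have sub: "D1 \<subseteq> S1" "D2 \<subseteq> S2" using D W by (auto simp: partition_on_def)
    \<comment> \<open>\<open>t\<close> decides whether \<open>f2\<close> or its negation is used on
      \<open>S2\<close>; \<open>f2 u = t\<close> is one or the other. The choice makes the values
      agree at one glued pair of vertices. Both functions change along the glued edges, so they
      agree at the other pair too.\<close>
    define t where "t \<longleftrightarrow> (f1 e = (if gl = {(g e, g h), (e, h)} then f2 h else f2 (g h)))"
    define f' where "f' u = (if u \<in> S1 then f1 u else f2 u = t)" for u
    have "f' u = f' v" if "(u, v) \<in> r1 \<union> r2 \<union> gl" for u v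
    proof -
      have "f' u = f' v" if uv: "(u, v) \<in> r1"
      proof -
        have "u \<in> S1" "v \<in> S1" "f1 u = f1 v" using f1(1) r(1) uv by auto
        then show ?thesis by (simp add: f'_def)
      qed
      moreover have "f' u = f' v" if uv: "(u, v) \<in> r2"
      proof -
        have "u \<notin> S1" "v \<notin> S1" "f2 u = f2 v" using f2(1) r(2) uv not1 by auto
        then show ?thesis by (simp add: f'_def)
      qed
      moreover have "f' u = f' v" if uv: "(u, v) \<in> gl"
      proof (cases "gl = {(g e, g h), (e, h)}")
        case True
        then have "t \<longleftrightarrow> f1 e = f2 h" "(u, v) = (g e, g h) \<or> (u, v) = (e, h)" using uv by (auto simp: t_def)
        then show ?thesis using mem not1 fe fh unfolding f'_def by auto
      next
        case False
        then have "t \<longleftrightarrow> f1 e = f2 (g h)" "(u, v) = (g e, h) \<or> (u, v) = (e, g h)"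
          using uv gl by (auto simp: t_def)
        then show ?thesis using mem not1 fe fh unfolding f'_def by auto
      qed
      ultimately show ?thesis using that by blast
    qed
    moreover have "f' u \<noteq> f' (g u) \<longleftrightarrow> u \<in> D" if "u \<in> S1 \<union> S2" for u
    proof (cases "u \<in> S1")
      case True
      then have "u \<notin> D2" using sub not1 by blast
      then show ?thesis using True f1(2) gS1 3 unfolding f'_def by simp
    next
      case False
      then have "u \<in> S2" "u \<notin> D1" using that sub by auto
      then show ?thesis using bspec[OF f2(2) \<open>u \<in> S2\<close>] not1 gS2 3 unfolding f'_def by auto
    qed
    ultimately show ?thesis by (intro exI[of _ f']) auto
  qed
qed


section \<open>The three segments\<close>

text \<open>\<open>cycle_of_list\<close> is the transposition of the first two entries applied after
  the cycle of the tail, so the left end is peeled off.\<close>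

lemma cycle_of_upt:
  "a \<le> x \<Longrightarrow> x \<le> b \<Longrightarrow> cycle_of_list [a..<Suc b] x = (if x = b then a else Suc x)"
proof (induction "b - a" arbitrary: a)
  case 0
  then show ?case by simp
next
  case (Suc n)
  then have ab: "a < b" by simp
  then have l: "[a..<Suc b] = a # Suc a # [Suc (Suc a)..<Suc b]"
    by (simp add: upt_rec[of a "Suc b"] upt_rec[of "Suc a" "Suc b"] del: upt_Suc)
  have l': "Suc a # [Suc (Suc a)..<Suc b] = [Suc a..<Suc b]"
    using ab by (simp add: upt_rec[of "Suc a" "Suc b"] del: upt_Suc)
  have eq: "cycle_of_list [a..<Suc b] x = transpose a (Suc a) (cycle_of_list [Suc a..<Suc b] x)"
    unfolding l cycle_of_list.simps comp_apply unfolding l' ..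
  show ?case
  proof (cases "x = a")
    case True
    then have "cycle_of_list [Suc a..<Suc b] x = x" by (intro id_outside_supp) simp
    then show ?thesis using eq True ab by simp
  next
    case False
    then have "cycle_of_list [Suc a..<Suc b] x = (if x = b then Suc a else Suc x)"
      using Suc by (intro Suc.hyps(1)) auto
    then show ?thesis using eq False Suc.prems ab by (simp add: transpose_def)
  qed
qed

lemma three_distinct:
  assumes "{i, j, k} = {0, 1, 2 :: nat}"
  shows "i < 3" "j < 3" "k < 3" "i \<noteq> j" "i \<noteq> k" "j \<noteq> k"
proof -
  have "card {i, j, k} = 3" using assms by simp
  then show "i \<noteq> j" "i \<noteq> k" "j \<noteq> k" by (auto simp: card_insert_if split: if_splits)
  have "i \<in> {0, 1, 2}" "j \<in> {0, 1, 2}" "k \<in> {0, 1, 2}" using assms by blast+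
  then show "i < 3" "j < 3" "k < 3" by auto
qed

lemma all_less_three: "(\<forall>l<3. Q l) \<longleftrightarrow> Q 0 \<and> Q 1 \<and> Q (2 :: nat)"
  by (auto simp: numeral_3_eq_3 less_Suc_eq numeral_2_eq_2)

locale three_cycles =
  fixes m1 m2 m3 :: nat
  assumes pos: "m1 \<ge> 1" "m2 \<ge> 1" "m3 \<ge> 1"
begin

abbreviation ms :: "nat list" where "ms \<equiv> [m1, m2, m3]"
abbreviation A :: "nat set" where "A \<equiv> {1..m1 + m2 + m3}"
abbreviation S :: "nat \<Rightarrow> nat set" where "S \<equiv> seg ms"
abbreviation g :: "nat \<Rightarrow> nat" where "g \<equiv> gamma ms"

definition first :: "nat \<Rightarrow> nat" where
  "first l = (if l = 0 then 1 else if l = 1 then m1 + 1 else m1 + m2 + 1)"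

definition final :: "nat \<Rightarrow> nat" where
  "final l = (if l = 0 then m1 else if l = 1 then m1 + m2 else m1 + m2 + m3)"

lemma points_eq: "points ms = A"
  by (simp add: add.assoc)

lemma seg_list_eq: "l < 3 \<Longrightarrow> seg_list ms l = [first l..<Suc (final l)]"
  by (auto simp: seg_list_def first_def final_def numeral_3_eq_3 less_Suc_eq add.assoc)

lemma S_eq: "l < 3 \<Longrightarrow> S l = {first l..final l}"
  using seg_list_eq[of l] by (simp add: atLeastLessThanSuc_atLeastAtMost del: upt_Suc)

lemma first_le_final: "first l \<le> final l"
  using pos by (auto simp: first_def final_def)

lemma A_eq: "A = S 0 \<union> S 1 \<union> S 2"
  using pos by (auto simp: S_eq first_def final_def)

lemma S_subset: "l < 3 \<Longrightarrow> S l \<subseteq> A"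
  using pos by (auto simp: S_eq first_def final_def)

lemma S_disjoint: "l < 3 \<Longrightarrow> l' < 3 \<Longrightarrow> l \<noteq> l' \<Longrightarrow> S l \<inter> S l' = {}"
  using pos by (auto simp: S_eq first_def final_def split: if_splits)

lemma S_unique: "x \<in> S l \<Longrightarrow> x \<in> S l' \<Longrightarrow> l < 3 \<Longrightarrow> l' < 3 \<Longrightarrow> l = l'"
  using S_disjoint by blast

lemma A_cases:
  assumes "x \<in> A"
  obtains l where "l < 3" "x \<in> S l"
  using assms that[of 0] that[of 1] that[of 2] unfolding A_eq by auto

lemma A_eq_perm: "{i, j, k} = {0, 1, 2} \<Longrightarrow> A = S i \<union> S j \<union> S k"
proof -
  assume "{i, j, k} = {0, 1, 2}"
  then have "\<Union>(S ` {i, j, k}) = \<Union>(S ` {0, 1, 2})" by simp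
  then show ?thesis unfolding A_eq by (simp add: Un_assoc)
qed

text \<open>The three cycles have disjoint supports: the other two fix both \<open>x\<close> and its
  image.\<close>

lemma g_on_S:
  assumes l: "l < 3" and x: "x \<in> S l"
  shows "g x = (if x = final l then first l else Suc x)"
proof -
  define c where "c l = cycle_of_list (seg_list ms l)" for l
  have out: "c l' y = y" if "y \<notin> S l'" for l' y
    unfolding c_def using that by (intro id_outside_supp)
  have inn: "c l x = (if x = final l then first l else Suc x)"
    using x l cycle_of_upt[of "first l" x "final l"] unfolding c_def S_eq[OF l] seg_list_eq[OF l]
    by (simp del: upt_Suc)
  have "c l x \<in> S l" using x l inn first_le_final[of l] unfolding S_eq[OF l] by auto
  moreover have "c l' y = y" if "y \<in> S l" "l' < 3" "l' \<noteq> l" for l' y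
    by (rule out) (use S_unique[of y l l'] l that in blast)
  ultimately have cc: "c l' (c l x) = c l x" "c l' x = x" if "l' < 3" "l' \<noteq> l" for l'
    using that x by blast+
  have gx: "g x = c 0 (c 1 (c 2 x))"
    by (simp add: gamma_def c_def numeral_2_eq_2 upt_rec)
  have "l = 0 \<or> l = 1 \<or> l = 2" using l by linarith
  then have "g x = c l x"
  proof (elim disjE)
    assume "l = 0"
    then show ?thesis using gx cc(2)[of 1] cc(2)[of 2] by simp
  next
    assume "l = 1"
    then show ?thesis using gx cc(2)[of 2] cc(1)[of 0] by simp
  next
    assume "l = 2"
    then show ?thesis using gx cc(1)[of 0] cc(1)[of 1] by simp
  qed
  then show ?thesis using inn by simp
qed

lemma rotation_S: "l < 3 \<Longrightarrow> rotation (first l) (final l) g"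
  using g_on_S first_le_final by unfold_locales (auto simp: S_eq)

lemma g_S: "l < 3 \<Longrightarrow> g ` S l \<subseteq> S l"
  using rotation.g_image[OF rotation_S] S_eq by metis

lemma g_A: "g ` A \<subseteq> A"
  unfolding A_eq image_Un using g_S[of 0] g_S[of 1] g_S[of 2] by auto

lemma cycle_quotient_eq: "cycle_quotient ms P l = fun_quotient (S l) g (restrict_part P (S l))"
  by (simp add: cycle_graph_def)

lemma cycles_quotient_eq: "cycles_quotient ms P = fun_quotient A g P"
  by (simp add: cycles_graph_def add.assoc)

lemma edge_gluings_eq:
  "edge_gluings (cycles_graph ms) p q = {{(g p, g q), (p, q)}, {(g p, q), (p, g q)}}"
  by (simp add: edge_gluings_def cycles_graph_def)

end

section \<open>Gluing three double trees\<close>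

context three_cycles
begin

definition nc_on_segments :: "(nat \<Rightarrow> nat) \<Rightarrow> bool" where
  "nc_on_segments \<pi> \<longleftrightarrow> (\<forall>l<3. pairing_on (S l) \<pi> \<and> noncrossing_on (S l) \<pi>)"

text \<open>The edges to be glued are given by representatives, and \<open>j\<close> is the middle
  tree. The last condition says that the two edges of the middle tree belong to different
  classes.\<close>

definition gluing_data :: "(nat \<Rightarrow> nat) \<Rightarrow> nat \<Rightarrow> nat \<Rightarrow> nat \<Rightarrow> nat \<Rightarrow> nat \<Rightarrow> nat \<Rightarrow> nat \<Rightarrow> bool" where
  "gluing_data \<pi> i j k p q p' q' \<longleftrightarrow> nc_on_segments \<pi> \<and> {i, j, k} = {0, 1, 2} \<and>
     p \<in> S j \<and> q \<in> S i \<and> p' \<in> S j \<and> q' \<in> S k \<and> p' \<notin> {p, \<pi> p}"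

text \<open>This family plays two roles: it is the block partition of a partitioned permutation, and
  it consists of the edge classes expected of the glued graph.\<close>

definition merged :: "(nat \<Rightarrow> nat) \<Rightarrow> nat \<Rightarrow> nat \<Rightarrow> nat \<Rightarrow> nat \<Rightarrow> nat set set" where
  "merged \<pi> p q p' q' =
     pairs A \<pi> - {{p, \<pi> p}, {q, \<pi> q}, {p', \<pi> p'}, {q', \<pi> q'}} \<union>
     {{p, \<pi> p} \<union> {q, \<pi> q}, {p', \<pi> p'} \<union> {q', \<pi> q'}}"

abbreviation tree_part :: "(nat \<Rightarrow> nat) \<Rightarrow> nat \<Rightarrow> nat set set" where
  "tree_part \<pi> l \<equiv> pair_part (S l) g \<pi>"

text \<open>In \<open>tree_type_244\<close> the partition occurs on both sides of its equation,
  through its restrictions. Here tree partitions built from the pairing replace the restrictions, so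
  that the right-hand side becomes an explicit construction.\<close>

definition glue_rel :: "(nat \<Rightarrow> nat) \<Rightarrow> (nat \<times> nat) set \<Rightarrow> (nat \<times> nat) set \<Rightarrow> (nat \<times> nat) set" where
  "glue_rel \<pi> G G' = (\<Union>l<3. part_rel (tree_part \<pi> l)) \<union> G \<union> G'"

definition glued :: "(nat \<Rightarrow> nat) \<Rightarrow> (nat \<times> nat) set \<Rightarrow> (nat \<times> nat) set \<Rightarrow> nat set set" where
  "glued \<pi> G G' = generated_part A (glue_rel \<pi> G G')"

abbreviation gluings :: "nat \<Rightarrow> nat \<Rightarrow> (nat \<times> nat) set set" where
  "gluings p q \<equiv> edge_gluings (cycles_graph ms) p q"

lemma nc_segD:
  assumes "nc_on_segments \<pi>" "l < 3"
  shows "pairing_on (S l) \<pi>" "noncrossing_on (S l) \<pi>"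
  using assms by (auto simp: nc_on_segments_def)

lemma pairing_on_A:
  assumes "nc_on_segments \<pi>"
  shows "pairing_on A \<pi>"
  using nc_segD(1)[OF assms, of 0] nc_segD(1)[OF assms, of 1] nc_segD(1)[OF assms, of 2]
  unfolding A_eq by (auto simp: pairing_on_def)

lemma partition_on_tree_part: "partition_on (S l) (tree_part \<pi> l)"
  unfolding pair_part_def by (rule partition_on_generated)

lemma pair_rel_tree_part:
  assumes "nc_on_segments \<pi>" "l < 3"
  shows "pair_rel (S l) g \<pi> \<subseteq> part_rel (tree_part \<pi> l)"
  unfolding pair_part_def
  by (intro generated_part_superset pair_rel_subset nc_segD[OF assms] g_S assms)

lemma cut_family_tree_part:
  assumes "nc_on_segments \<pi>" "l < 3"
  shows "cut_family (S l) g (part_rel (tree_part \<pi> l)) (pairs (S l) \<pi>)"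
proof -
  have "cut_family (S l) g (pair_rel (S l) g \<pi>) (pairs (S l) \<pi>)"
    using rotation.noncrossing_imp_cut[OF rotation_S[OF assms(2)]] nc_segD[OF assms] S_eq[OF assms(2)]
    by simp
  then show ?thesis unfolding pair_part_def by (rule cut_family_generated)
qed

lemma double_tree_tree_part:
  assumes "nc_on_segments \<pi>" "l < 3"
  shows "double_tree (fun_quotient (S l) g (tree_part \<pi> l))"
    and "x \<in> S l \<Longrightarrow> edge_class (fun_quotient (S l) g (tree_part \<pi> l)) x = {x, \<pi> x}"
  using rotation.cut_imp_double_tree[OF rotation_S[OF assms(2)], folded S_eq[OF assms(2)],
      OF partition_on_tree_part nc_segD(1)[OF assms] pair_rel_tree_part[OF assms] cut_family_tree_part[OF assms]]
  by blast+

lemma double_tree_restrict_imp: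
  assumes P: "partition_on A P" and l: "l < 3" and dt: "double_tree (cycle_quotient ms P l)"
  obtains \<pi> where "pairing_on (S l) \<pi>" "noncrossing_on (S l) \<pi>"
    "restrict_part P (S l) = tree_part \<pi> l"
proof -
  note Q = partition_on_restrict_part[OF P S_subset[OF l]]
  obtain \<pi> where \<pi>: "pairing_on (S l) \<pi>" "pair_rel (S l) g \<pi> \<subseteq> part_rel (restrict_part P (S l))"
    "cut_family (S l) g (part_rel (restrict_part P (S l))) (pairs (S l) \<pi>)"
    by (rule double_tree_imp_pairing[OF Q g_S[OF l] dt[unfolded cycle_quotient_eq]])
  note rot = rotation_S[OF l]
  show thesis
    by (rule that[OF \<pi>(1) rotation.cut_imp_noncrossing[OF rot, folded S_eq[OF l], OF Q \<pi>]
          rotation.cut_imp_pair_part[OF rot, folded S_eq[OF l], OF Q \<pi>]])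
qed

lemma pairs_A:
  assumes "{i, j, k} = {0, 1, 2}"
  shows "pairs A \<pi> = pairs (S j) \<pi> \<union> pairs (S i) \<pi> \<union> pairs (S k) \<pi>"
  unfolding A_eq_perm[OF assms] pairs_def by blast

section \<open>Edge classes expected of the glued graph\<close>

context
  fixes \<pi> i j k p q p' q'
  assumes data: "gluing_data \<pi> i j k p q p' q'"
begin

lemma nc: "nc_on_segments \<pi>" and ijk: "{i, j, k} = {0, 1, 2}"
  and pS: "p \<in> S j" "q \<in> S i" "p' \<in> S j" "q' \<in> S k" and ne: "p' \<notin> {p, \<pi> p}"
  using data by (auto simp: gluing_data_def)

lemmas lt = three_distinct(1-3)[OF ijk] and neq = three_distinct(4-6)[OF ijk]

text \<open>This is the form produced by two applications of the gluing lemmas. It is correct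
  because pairs from different segments are different, and because a fused class, which meets two
  segments, is never a pair.\<close>

lemma merged_iterated:
  "merged \<pi> p q p' q' =
     (pairs (S j) \<pi> - {{p, \<pi> p}} \<union> (pairs (S i) \<pi> - {{q, \<pi> q}}) \<union> {{p, \<pi> p} \<union> {q, \<pi> q}}) -
       {{p', \<pi> p'}} \<union> (pairs (S k) \<pi> - {{q', \<pi> q'}}) \<union> {{p', \<pi> p'} \<union> {q', \<pi> q'}}"
  (is "_ = ?R")
proof -
  have sub: "B \<subseteq> S l \<and> B \<noteq> {}" if "B \<in> pairs (S l) \<pi>" "l < 3" for B l
    using that nc_segD(1)[OF nc that(2)] by (auto simp: pairs_def pairing_on_def)
  have excl: "B \<notin> pairs (S l') \<pi>" if "B \<in> pairs (S l) \<pi>" "l < 3" "l' < 3" "l \<noteq> l'" for B l l'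
    using sub[OF that(1,2)] sub[of B l'] S_disjoint[OF that(2-4)] that by blast
  have set_eq: "J \<union> I \<union> K - {a, b, c, d} \<union> {x, y} = (J - {a} \<union> (I - {b}) \<union> {x}) - {c} \<union> (K - {d}) \<union> {y}"
    if "x \<noteq> c" "a \<notin> I" "a \<notin> K" "c \<notin> I" "c \<notin> K" "b \<notin> J" "b \<notin> K" "d \<notin> J" "d \<notin> I"
    for J I K :: "nat set set" and a b c d x y
    using that by auto
  have P: "{p, \<pi> p} \<in> pairs (S j) \<pi>" "{q, \<pi> q} \<in> pairs (S i) \<pi>"
    "{p', \<pi> p'} \<in> pairs (S j) \<pi>" "{q', \<pi> q'} \<in> pairs (S k) \<pi>"
    using pS by (auto intro: pairs_mem)
  have "q \<notin> {p', \<pi> p'}"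
    using sub[OF P(3) lt(2)] pS(2) S_disjoint[OF lt(1,2) neq(1)] by blast
  then have n1: "{p, \<pi> p} \<union> {q, \<pi> q} \<noteq> {p', \<pi> p'}" by blast
  have e: "{p, \<pi> p} \<notin> pairs (S i) \<pi>" "{p, \<pi> p} \<notin> pairs (S k) \<pi>"
    "{p', \<pi> p'} \<notin> pairs (S i) \<pi>" "{p', \<pi> p'} \<notin> pairs (S k) \<pi>"
    "{q, \<pi> q} \<notin> pairs (S j) \<pi>" "{q, \<pi> q} \<notin> pairs (S k) \<pi>"
    "{q', \<pi> q'} \<notin> pairs (S j) \<pi>" "{q', \<pi> q'} \<notin> pairs (S i) \<pi>"
    using excl P lt neq by metis+
  show ?thesis
    unfolding merged_def pairs_A[OF ijk] by (rule set_eq[OF n1 e])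
qed

lemma partition_on_merged: "partition_on A (merged \<pi> p q p' q')"
  and cut_family_merged:
    "G \<in> gluings p q \<Longrightarrow> G' \<in> gluings p' q' \<Longrightarrow> cut_family A g (glue_rel \<pi> G G') (merged \<pi> p q p' q')"
proof -
  let ?W1 = "pairs (S j) \<pi> - {{p, \<pi> p}} \<union> (pairs (S i) \<pi> - {{q, \<pi> q}}) \<union> {{p, \<pi> p} \<union> {q, \<pi> q}}"
  have part: "partition_on (S l) (pairs (S l) \<pi>)" if "l < 3" for l
    by (rule partition_on_pairs[OF nc_segD(1)[OF nc that]])
  have rS: "part_rel (tree_part \<pi> l) \<subseteq> S l \<times> S l" for l
    using part_rel_mem[OF partition_on_tree_part] by auto
  have D: "{p, \<pi> p} \<in> pairs (S j) \<pi>" "{q, \<pi> q} \<in> pairs (S i) \<pi>"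
    "{p', \<pi> p'} \<in> pairs (S j) \<pi>" "{q', \<pi> q'} \<in> pairs (S k) \<pi>"
    using pS by (auto intro: pairs_mem)
  have d1: "S j \<inter> S i = {}" using S_disjoint lt neq by metis
  have d2: "(S j \<union> S i) \<inter> S k = {}"
    using S_disjoint[OF lt(2) lt(3)] S_disjoint[OF lt(1) lt(3)] neq by blast
  have W1: "partition_on (S j \<union> S i) ?W1"
    by (rule partition_on_glue[OF part[OF lt(2)] part[OF lt(1)] d1 D(1,2)])
  \<comment> \<open>The pair of \<open>p'\<close> survives the first gluing and is therefore
    available for the second.\<close>
  have "{p', \<pi> p'} \<noteq> {p, \<pi> p}" using ne by blast
  then have D3: "{p', \<pi> p'} \<in> ?W1" using D(3) by blast
  have AA: "A = S j \<union> S i \<union> S k" using A_eq_perm[OF ijk] by blast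
  show "partition_on A (merged \<pi> p q p' q')"
    unfolding AA merged_iterated by (rule partition_on_glue[OF W1 part[OF lt(3)] d2 D3 D(4)])
  assume G: "G \<in> gluings p q" "G' \<in> gluings p' q'"
  have G1: "G = {(g p, g q), (p, q)} \<or> G = {(g p, q), (p, g q)}"
    and G2: "G' = {(g p', g q'), (p', q')} \<or> G' = {(g p', q'), (p', g q')}"
    using G unfolding edge_gluings_eq by auto
  let ?r = "part_rel (tree_part \<pi> j) \<union> part_rel (tree_part \<pi> i) \<union> G"
  have c1: "cut_family (S j \<union> S i) g ?r ?W1"
    by (rule cut_family_glue[OF d1 g_S[OF lt(2)] g_S[OF lt(1)] rS rS
        cut_family_tree_part[OF nc lt(2)] cut_family_tree_part[OF nc lt(1)]
        part[OF lt(2)] part[OF lt(1)] D(1) _ D(2) _ G1]) auto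
  have g12: "g ` (S j \<union> S i) \<subseteq> S j \<union> S i" using g_S[OF lt(1)] g_S[OF lt(2)] by blast
  have "G \<subseteq> (S j \<union> S i) \<times> (S j \<union> S i)"
    using G1 pS g_S[OF lt(1)] g_S[OF lt(2)] by auto
  then have r12: "?r \<subseteq> (S j \<union> S i) \<times> (S j \<union> S i)"
    using rS[of i] rS[of j] by blast
  have c2: "cut_family (S j \<union> S i \<union> S k) g (?r \<union> part_rel (tree_part \<pi> k) \<union> G')
      (?W1 - {{p', \<pi> p'}} \<union> (pairs (S k) \<pi> - {{q', \<pi> q'}}) \<union> {{p', \<pi> p'} \<union> {q', \<pi> q'}})"
    by (rule cut_family_glue[OF d2 g12 g_S[OF lt(3)] r12 rS c1 cut_family_tree_part[OF nc lt(3)]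
        W1 part[OF lt(3)] D3 _ D(4) _ G2]) auto
  have "{..<3} = {i, j, k}" unfolding ijk by auto
  then have "glue_rel \<pi> G G' = ?r \<union> part_rel (tree_part \<pi> k) \<union> G'"
    unfolding glue_rel_def by auto
  then show "cut_family A g (glue_rel \<pi> G G') (merged \<pi> p q p' q')"
    using c2 unfolding AA merged_iterated by simp
qed

lemma merged_cases:
  assumes "D \<in> merged \<pi> p q p' q'"
  obtains "D \<in> pairs A \<pi>" | "D = {p, \<pi> p} \<union> {q, \<pi> q}" | "D = {p', \<pi> p'} \<union> {q', \<pi> q'}"
  using assms unfolding merged_def by blast

text \<open>Fused pairs come from different segments, so a class meets a segment in at most one
  pair. Thus cuts of the glued graph restrict to cuts of the single trees.\<close>

lemma merged_Int_segment:
  assumes "D \<in> merged \<pi> p q p' q'" "z \<in> D" "z \<in> S l" "l < 3"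
  shows "D \<inter> S l = {z, \<pi> z}"
proof -
  have *: "w \<in> S l' \<Longrightarrow> \<pi> w \<in> S l' \<and> \<pi> (\<pi> w) = w" if "l' < 3" for w l'
    using pairing_onD[OF nc_segD(1)[OF nc that]] by blast
  have one: "\<pi> z \<in> {w, \<pi> w} \<and> {w, \<pi> w} \<inter> S l = {z, \<pi> z}" if "w \<in> S l'" "l' < 3" "z \<in> {w, \<pi> w}" for w l'
  proof -
    have "l' = l" using that *[OF that(2,1)] S_unique[OF _ assms(3) that(2) assms(4)] by auto
    then show ?thesis using that *[OF that(2,1)] by auto
  qed
  have none: "{w, \<pi> w} \<inter> S l = {}" if "w \<in> S l'" "l' < 3" "l' \<noteq> l" for w l'
    using *[OF that(2,1)] that S_disjoint[OF that(2) assms(4) that(3)] by auto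
  have two: "({w, \<pi> w} \<union> {w', \<pi> w'}) \<inter> S l = {z, \<pi> z}"
    if w: "w \<in> S l1" "w' \<in> S l2" "l1 < 3" "l2 < 3" "l1 \<noteq> l2" and z: "z \<in> {w, \<pi> w} \<union> {w', \<pi> w'}"
    for w w' l1 l2
  proof (cases "z \<in> {w, \<pi> w}")
    case True
    then have "l1 = l" using *[OF w(3,1)] S_unique[OF _ assms(3) w(3) assms(4)] w by auto
    then show ?thesis using one[OF w(1,3) True] none[OF w(2,4)] w(5) unfolding Int_Un_distrib2 by auto
  next
    case False
    then have z': "z \<in> {w', \<pi> w'}" using z by blast
    then have "l2 = l" using *[OF w(4,2)] S_unique[OF _ assms(3) w(4) assms(4)] w by auto
    then show ?thesis using one[OF w(2,4) z'] none[OF w(1,3)] w(5) unfolding Int_Un_distrib2 by auto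
  qed
  from assms(1) show ?thesis
  proof (cases rule: merged_cases)
    case 1
    then obtain w where w: "w \<in> A" "D = {w, \<pi> w}" by (auto simp: pairs_def)
    then obtain l' where "l' < 3" "w \<in> S l'" using A_cases by blast
    then show ?thesis using one w assms(2) by blast
  next
    case 2
    then show ?thesis using two[OF pS(1,2) lt(2,1)] neq assms(2) by auto
  next
    case 3
    then show ?thesis using two[OF pS(3,4) lt(2,3)] neq assms(2) by auto
  qed
qed

section \<open>The partition for a fixed choice of the two gluings\<close>

context
  fixes G G'
  assumes G: "G \<in> gluings p q" and G': "G' \<in> gluings p' q'"
begin

abbreviation GP :: "nat set set" where "GP \<equiv> glued \<pi> G G'"

lemma partition_on_glued: "partition_on A GP"
  unfolding glued_def by (rule partition_on_generated)

lemma glue_rel_subset: "glue_rel \<pi> G G' \<subseteq> A \<times> A"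
proof -
  have "part_rel (tree_part \<pi> l) \<subseteq> A \<times> A" if "l < 3" for l
  proof -
    have "part_rel (tree_part \<pi> l) \<subseteq> S l \<times> S l"
      using part_rel_mem[OF partition_on_tree_part] by auto
    then show ?thesis using S_subset[OF that] by blast
  qed
  moreover have pA: "p \<in> A" "q \<in> A" "p' \<in> A" "q' \<in> A" using pS S_subset lt by blast+
  moreover have "g p \<in> A" "g q \<in> A" "g p' \<in> A" "g q' \<in> A" using pA g_A by blast+
  ultimately show ?thesis
    using G G' unfolding glue_rel_def edge_gluings_eq by auto
qed

lemma glue_rel_le: "glue_rel \<pi> G G' \<subseteq> part_rel GP"
  unfolding glued_def by (rule generated_part_superset[OF glue_rel_subset])

lemma cut_family_glued: "cut_family A g (part_rel GP) (merged \<pi> p q p' q')"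
  unfolding glued_def by (intro cut_family_generated cut_family_merged G G')

text \<open>Gluing creates no new identification inside a tree: points of \<open>S l\<close>
  identified in \<open>GP\<close> are separated by no cut of \<open>GP\<close>, every pair of
  \<open>S l\<close> is the trace of such a cut, and \<open>cuts_separate\<close> applies. It asks
  the cuts only for \<open>f x = f y\<close>, because here \<open>(x, y)\<close> is not yet known to
  be related in the tree.\<close>

lemma restrict_glued:
  assumes l: "l < 3"
  shows "restrict_part GP (S l) = tree_part \<pi> l"
proof -
  note Q = partition_on_tree_part[where l = l and \<pi> = \<pi>]
  have QR: "part_rel (tree_part \<pi> l) \<subseteq> part_rel GP"
    using glue_rel_le l unfolding glue_rel_def by blast
  have le: "(x, y) \<in> part_rel (tree_part \<pi> l)"
    if xy: "(x, y) \<in> part_rel GP" "x \<in> S l" "y \<in> S l" "x \<le> y" for x y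
  proof (rule rotation.cuts_separate[OF rotation_S[OF l], folded S_eq[OF l],
        OF nc_segD(1)[OF nc l] equiv_part_rel[OF Q] pair_rel_tree_part[OF nc l] xy(2-4)])
    fix z assume z: "z \<in> S l"
    then have "z \<in> A" using S_subset[OF l] by blast
    then have "z \<in> \<Union>(merged \<pi> p q p' q')"
      using partition_on_merged unfolding partition_on_def by simp
    then obtain D where D: "D \<in> merged \<pi> p q p' q'" "z \<in> D" by blast
    obtain f :: "nat \<Rightarrow> bool" where f: "\<forall>(u, v)\<in>part_rel GP. f u = f v"
      "\<forall>u\<in>A. f u \<noteq> f (g u) \<longleftrightarrow> u \<in> D"
      by (rule cut_familyE[OF cut_family_glued D(1)])
    have "f u \<noteq> f (g u) \<longleftrightarrow> u \<in> {z, \<pi> z}" if "u \<in> S l" for u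
    proof -
      have "f u \<noteq> f (g u) \<longleftrightarrow> u \<in> D" using f(2) that S_subset[OF l] by blast
      also have "\<dots> \<longleftrightarrow> u \<in> D \<inter> S l" using that by simp
      finally show ?thesis unfolding merged_Int_segment[OF D z l] .
    qed
    then show "\<exists>f :: nat \<Rightarrow> bool. (\<forall>(u, v)\<in>part_rel (tree_part \<pi> l). f u = f v) \<and>
        (\<forall>u\<in>S l. f u \<noteq> f (g u) \<longleftrightarrow> u \<in> {z, \<pi> z}) \<and> f x = f y"
      using f(1) QR xy(1) by (intro exI[of _ f] conjI ballI) auto
  qed
  have "part_rel (restrict_part GP (S l)) \<subseteq> part_rel (tree_part \<pi> l)"
  proof
    fix u assume "u \<in> part_rel (restrict_part GP (S l))"
    then obtain x y where u: "u = (x, y)" "(x, y) \<in> part_rel GP" "x \<in> S l" "y \<in> S l"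
      unfolding part_rel_restrict_part by (cases u) auto
    then have "(y, x) \<in> part_rel GP" by (auto intro: part_rel_sym)
    then show "u \<in> part_rel (tree_part \<pi> l)"
      using le[of x y] le[of y x] u part_rel_sym by (metis nle_le)
  qed
  moreover have "part_rel (tree_part \<pi> l) \<subseteq> part_rel (restrict_part GP (S l))"
    unfolding part_rel_restrict_part using QR part_rel_mem[OF Q] by auto
  ultimately show ?thesis
    by (intro part_rel_inject[OF partition_on_restrict_part[OF partition_on_glued S_subset[OF l]] Q]) auto
qed

text \<open>Pairs and gluings are chained in \<open>edge_equiv\<close>, whose transitivity is
  immediate, and translated back to \<open>same_ends\<close> at the end.\<close>

lemma same_ends_merged:
  assumes D: "D \<in> merged \<pi> p q p' q'" "x \<in> D" "y \<in> D"
  shows "same_ends g (part_rel GP) x y"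
proof -
  have pr: "pair_rel A g \<pi> \<subseteq> part_rel GP"
  proof
    fix u assume "u \<in> pair_rel A g \<pi>"
    then obtain x where x: "x \<in> A" "u = (g (\<pi> x), x)" by (auto simp: pair_rel_def)
    then obtain l where l: "l < 3" "x \<in> S l" using A_cases by blast
    then have "u \<in> pair_rel (S l) g \<pi>" using x by (auto simp: pair_rel_def)
    then show "u \<in> part_rel GP"
      using pair_rel_tree_part[OF nc l(1)] glue_rel_le l(1) unfolding glue_rel_def by blast
  qed
  have eqv: "(u, v) \<in> edge_equiv (fun_quotient A g GP) \<longleftrightarrow> u \<in> A \<and> v \<in> A \<and> same_ends g (part_rel GP) u v" for u v
    by (rule edge_equiv_fun_quotient[OF partition_on_glued subset_refl g_A])
  have eq: "equiv A (edge_equiv (fun_quotient A g GP))"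
    using equiv_edge_equiv[of "fun_quotient A g GP"] by (simp add: quotient_graph_def)
  have pair: "(u, v) \<in> edge_equiv (fun_quotient A g GP)" if "B \<in> pairs A \<pi>" "u \<in> B" "v \<in> B" for B u v
  proof -
    have "B \<subseteq> A" using that(1) pairing_on_A[OF nc] by (auto simp: pairs_def pairing_on_def)
    then show ?thesis unfolding eqv
      using same_ends_pairs[OF partition_on_glued subset_refl g_A pairing_on_A[OF nc] pr that] that by blast
  qed
  have pA: "p \<in> A" "q \<in> A" "p' \<in> A" "q' \<in> A" using pS S_subset lt by blast+
  have glue: "(u, v) \<in> edge_equiv (fun_quotient A g GP)"
    if "H \<subseteq> part_rel GP" "H \<in> gluings u v" "u \<in> A" "v \<in> A" for H u v
    using that unfolding eqv edge_gluings_eq same_ends_def by auto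
  have pq: "(p, q) \<in> edge_equiv (fun_quotient A g GP)"
    by (rule glue[OF _ G pA(1,2)]) (use glue_rel_le in \<open>auto simp: glue_rel_def\<close>)
  have pq': "(p', q') \<in> edge_equiv (fun_quotient A g GP)"
    by (rule glue[OF _ G' pA(3,4)]) (use glue_rel_le in \<open>auto simp: glue_rel_def\<close>)
  have two: "(u, v) \<in> edge_equiv (fun_quotient A g GP)"
    if ab: "(a, b) \<in> edge_equiv (fun_quotient A g GP)" "a \<in> A" "b \<in> A"
      and uv: "u \<in> {a, \<pi> a} \<union> {b, \<pi> b}" "v \<in> {a, \<pi> a} \<union> {b, \<pi> b}" for u v a b
  proof -
    have 1: "(w, a) \<in> edge_equiv (fun_quotient A g GP)" if "w \<in> {a, \<pi> a}" for w
      using pair[OF pairs_mem[OF ab(2)], of w a] that by simp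
    have 2: "(w, b) \<in> edge_equiv (fun_quotient A g GP)" if "w \<in> {b, \<pi> b}" for w
      using pair[OF pairs_mem[OF ab(3)], of w b] that by simp
    have "(w, a) \<in> edge_equiv (fun_quotient A g GP)" if "w \<in> {a, \<pi> a} \<union> {b, \<pi> b}" for w
      using 1 2 that ab(1) eq by (meson Un_iff equiv_def symD transD)
    then show ?thesis using uv eq by (meson equiv_def symD transD)
  qed
  from D(1) have "(x, y) \<in> edge_equiv (fun_quotient A g GP)"
  proof (cases rule: merged_cases)
    case 1
    then show ?thesis using pair D by blast
  next
    case 2
    then show ?thesis using two[OF pq pA(1,2)] D by blast
  next
    case 3
    then show ?thesis using two[OF pq' pA(3,4)] D by blast
  qed
  then show ?thesis unfolding eqv by blast
qed

lemma edge_classes_glued: "A // edge_equiv (cycles_quotient ms GP) = merged \<pi> p q p' q'"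
  unfolding cycles_quotient_eq
  by (rule edge_classes_eq_cut[OF partition_on_glued subset_refl g_A partition_on_merged
      cut_family_glued same_ends_merged])

lemma edge_class_glued:
  "D \<in> merged \<pi> p q p' q' \<Longrightarrow> x \<in> D \<Longrightarrow> edge_class (cycles_quotient ms GP) x = D"
  unfolding cycles_quotient_eq
  by (rule edge_class_eq_cut[OF partition_on_glued subset_refl g_A partition_on_merged
      cut_family_glued same_ends_merged])

text \<open>The cut of the class containing \<open>x\<close> changes between \<open>x\<close> and
  \<open>g x\<close>.\<close>

lemma no_loops_glued: "x \<in> A \<Longrightarrow> (x, g x) \<notin> part_rel GP"
proof
  assume x: "x \<in> A" "(x, g x) \<in> part_rel GP"
  then have "x \<in> \<Union>(merged \<pi> p q p' q')"
    using partition_on_merged unfolding partition_on_def by simp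
  then obtain D where D: "D \<in> merged \<pi> p q p' q'" "x \<in> D" by blast
  obtain f :: "nat \<Rightarrow> bool" where f: "\<forall>(u, v)\<in>part_rel GP. f u = f v"
    "\<forall>u\<in>A. f u \<noteq> f (g u) \<longleftrightarrow> u \<in> D"
    by (rule cut_familyE[OF cut_family_glued D(1)])
  then show False using x D by blast
qed

lemma local_edge_class_glued:
  "l < 3 \<Longrightarrow> x \<in> S l \<Longrightarrow> edge_class (cycle_quotient ms GP l) x = {x, \<pi> x}"
  unfolding cycle_quotient_eq using restrict_glued double_tree_tree_part(2)[OF nc] by simp

lemma card_four:
  "card ({p, \<pi> p} \<union> {q, \<pi> q}) = 4" "card ({p', \<pi> p'} \<union> {q', \<pi> q'}) = 4"
proof -
  have four: "card ({u, \<pi> u} \<union> {v, \<pi> v}) = 4"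
    if uv: "u \<in> S l" "v \<in> S l'" and l: "l < 3" "l' < 3" "l \<noteq> l'" for u v l l'
  proof -
    note u = pairing_onD[OF nc_segD(1)[OF nc l(1)] uv(1)]
    note v = pairing_onD[OF nc_segD(1)[OF nc l(2)] uv(2)]
    have "{u, \<pi> u} \<subseteq> S l" "{v, \<pi> v} \<subseteq> S l'" using u v uv by blast+
    then have "{u, \<pi> u} \<inter> {v, \<pi> v} = {}"
      using S_disjoint[OF l] by blast
    then have "card ({u, \<pi> u} \<union> {v, \<pi> v}) = card {u, \<pi> u} + card {v, \<pi> v}"
      by (intro card_Un_disjoint) simp_all
    moreover have "card {u, \<pi> u} = 2" "card {v, \<pi> v} = 2"
      using u v by (metis card_2_iff)+
    ultimately show ?thesis by simp
  qed
  show "card ({p, \<pi> p} \<union> {q, \<pi> q}) = 4"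
    by (rule four[OF pS(1,2) lt(2,1) neq(1)[symmetric]])
  show "card ({p', \<pi> p'} \<union> {q', \<pi> q'}) = 4"
    by (rule four[OF pS(3,4) lt(2,3) neq(3)])
qed

lemma tree_type_glued: "tree_type_244 ms GP"
  unfolding tree_type_244_def
proof (intro conjI)
  show "\<forall>l<3. double_tree (cycle_quotient ms GP l)"
    unfolding cycle_quotient_eq using restrict_glued double_tree_tree_part(1)[OF nc] by simp
  have c1: "edge_class (cycle_quotient ms GP j) p \<noteq> edge_class (cycle_quotient ms GP j) p'"
    unfolding local_edge_class_glued[OF lt(2) pS(1)] local_edge_class_glued[OF lt(2) pS(3)]
    using ne by blast
  have "edge_class (cycles_quotient ms GP) p = {p, \<pi> p} \<union> {q, \<pi> q}"
    by (rule edge_class_glued) (auto simp: merged_def)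
  then have c2: "card (edge_class (cycles_quotient ms GP) p) = 4" using card_four by simp
  have "edge_class (cycles_quotient ms GP) p' = {p', \<pi> p'} \<union> {q', \<pi> q'}"
    by (rule edge_class_glued) (auto simp: merged_def)
  then have c3: "card (edge_class (cycles_quotient ms GP) p') = 4" using card_four by simp
  \<comment> \<open>With the restrictions computed, the self-referential equation becomes the
    definition of \<open>glued\<close>.\<close>
  have "(\<Union>l<3. part_rel (restrict_part GP (S l))) = (\<Union>l<3. part_rel (tree_part \<pi> l))"
    using restrict_glued by simp
  then have c4: "GP = generated_part (points ms) ((\<Union>l<3. part_rel (restrict_part GP (S l))) \<union> G \<union> G')"
    unfolding points_eq by (simp add: glued_def glue_rel_def)
  show "\<exists>i j k. {i, j, k} = {0, 1, 2} \<and>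
        (\<exists>p\<in>S j. \<exists>q\<in>S i. \<exists>p'\<in>S j. \<exists>q'\<in>S k. \<exists>G\<in>gluings p q. \<exists>G'\<in>gluings p' q'.
           edge_class (cycle_quotient ms GP j) p \<noteq> edge_class (cycle_quotient ms GP j) p' \<and>
           card (edge_class (cycles_quotient ms GP) p) = 4 \<and>
           card (edge_class (cycles_quotient ms GP) p') = 4 \<and>
           GP = generated_part (points ms)
                 ((\<Union>l<3. part_rel (restrict_part GP (S l))) \<union> G \<union> G'))"
    by (intro exI[of _ i] exI[of _ j] exI[of _ k] conjI bexI[OF _ pS(1)] bexI[OF _ pS(2)]
        bexI[OF _ pS(3)] bexI[OF _ pS(4)] bexI[OF _ G] bexI[OF _ G'] ijk c1 c2 c3 c4)
qed

end

end

end


section \<open>Partitioned permutations as readings of glued trees\<close>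

lemma part_relI: "B \<in> P \<Longrightarrow> x \<in> B \<Longrightarrow> y \<in> B \<Longrightarrow> (x, y) \<in> part_rel P"
  by (auto simp: part_rel_def)

lemma involution_permutes:
  assumes "\<And>x. x \<in> A \<Longrightarrow> p x \<in> A \<and> p (p x) = x" "\<And>x. x \<notin> A \<Longrightarrow> p x = x"
  shows "p permutes A"
proof -
  have "p (p x) = x" for x using assms by (cases "x \<in> A") auto
  then show ?thesis using assms(2) unfolding permutes_def by metis
qed

lemma orbit_involution:
  assumes "p (p x) = x"
  shows "orbit p x = {x, p x}"
proof
  show "orbit p x \<subseteq> {x, p x}"
  proof
    fix y assume "y \<in> orbit p x"
    then show "y \<in> {x, p x}" by induction (use assms in auto)
  qed
  have "p x \<in> orbit p x" by (rule orbit.base)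
  moreover from this have "p (p x) \<in> orbit p x" by (rule orbit.step)
  ultimately show "{x, p x} \<subseteq> orbit p x" using assms by simp
qed

lemma partition_on_subset_eq:
  assumes "partition_on A V" "partition_on A W" "V \<subseteq> W"
  shows "V = W"
proof
  show "W \<subseteq> V"
  proof
    fix B assume B: "B \<in> W"
    then obtain x where x: "x \<in> B" using assms(2) by (metis partition_onD3 ex_in_conv)
    then have "x \<in> A" using assms(2) B by (auto simp: partition_on_def)
    then obtain C where C: "C \<in> V" "x \<in> C" using assms(1) by (auto simp: partition_on_def)
    then have "B = C" using disjointD[OF partition_onD2[OF assms(2)], of B C] B x assms(3) by blast
    then show "B \<in> V" using C by simp
  qed
qed (rule assms(3))

lemma distinct_below_three:
  assumes "i < 3" "j < 3" "k < (3 :: nat)" "i \<noteq> j" "i \<noteq> k" "j \<noteq> k"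
  shows "{i, j, k} = {0, 1, 2}"
proof (rule card_subset_eq)
  show "{i, j, k} \<subseteq> {0, 1, 2}" using assms(1-3) by auto
qed (use assms(4-6) in simp_all)

text \<open>The segments are viewed as vertices and the two fused blocks as edges \<open>ab\<close>
  and \<open>cd\<close>. By \<open>cover\<close> every vertex is an end of an edge that is not a
  loop; with two edges on three vertices this leaves only a path, whose middle vertex is
  \<open>j\<close>.\<close>

lemma two_edges_span_three:
  assumes lt: "a < 3" "b < 3" "c < 3" "d < (3 :: nat)"
    and cover: "\<And>l. l < 3 \<Longrightarrow> (a = l) \<noteq> (b = l) \<or> (c = l) \<noteq> (d = l)"
  shows "\<exists>i j k. {i, j, k} = {0, 1, 2} \<and> (a = j \<and> b = i \<or> a = i \<and> b = j) \<and>
           (c = j \<and> d = k \<or> c = k \<and> d = j)"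
proof -
  have cov: "l \<in> {a, b, c, d}" if "l < 3" for l using cover[OF that] by auto
  have "{0, 1, 2} \<subseteq> {a, b, c, d}" using cov[of 0] cov[of 1] cov[of 2] by simp
  then have three: "3 \<le> card {a, b, c, d}" using card_mono[of "{a, b, c, d}" "{0, 1, 2}"] by simp
  have "a \<noteq> b"
  proof
    assume "a = b"
    then have "{0, 1, 2} \<subseteq> {c, d}" using cover[of 0] cover[of 1] cover[of 2] by auto
    then have "3 \<le> card {c, d}" using card_mono[of "{c, d}" "{0, 1, 2}"] by simp
    then show False by (simp add: card_insert_if split: if_splits)
  qed
  have "c \<noteq> d"
  proof
    assume "c = d"
    then have "{0, 1, 2} \<subseteq> {a, b}" using cover[of 0] cover[of 1] cover[of 2] by auto
    then have "3 \<le> card {a, b}" using card_mono[of "{a, b}" "{0, 1, 2}"] by simp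
    then show False by (simp add: card_insert_if split: if_splits)
  qed
  have "a = c \<or> a = d \<or> b = c \<or> b = d" using lt \<open>a \<noteq> b\<close> \<open>c \<noteq> d\<close> by linarith
  then show ?thesis
  proof (elim disjE)
    assume "a = c"
    moreover from this have "b \<noteq> d" using three by (auto simp: card_insert_if split: if_splits)
    ultimately show ?thesis
      using distinct_below_three[of b a d] lt \<open>a \<noteq> b\<close> \<open>c \<noteq> d\<close>
      by (intro exI[of _ b] exI[of _ a] exI[of _ d]) simp
  next
    assume "a = d"
    moreover from this have "b \<noteq> c" using three by (auto simp: card_insert_if split: if_splits)
    ultimately show ?thesis
      using distinct_below_three[of b a c] lt \<open>a \<noteq> b\<close> \<open>c \<noteq> d\<close>
      by (intro exI[of _ b] exI[of _ a] exI[of _ c]) simp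
  next
    assume "b = c"
    moreover from this have "a \<noteq> d" using three by (auto simp: card_insert_if split: if_splits)
    ultimately show ?thesis
      using distinct_below_three[of a b d] lt \<open>a \<noteq> b\<close> \<open>c \<noteq> d\<close>
      by (intro exI[of _ a] exI[of _ b] exI[of _ d]) simp
  next
    assume "b = d"
    moreover from this have "a \<noteq> c" using three by (auto simp: card_insert_if split: if_splits)
    ultimately show ?thesis
      using distinct_below_three[of a b c] lt \<open>a \<noteq> b\<close> \<open>c \<noteq> d\<close>
      by (intro exI[of _ a] exI[of _ b] exI[of _ c]) simp
  qed
qed

section \<open>Translation of both sides into gluing data\<close>

context three_cycles
begin

text \<open>Every edge of a tree is crossed by some cut, and no function can change along a
  loop.\<close>

lemma gamma_no_fixpoint:
  assumes "nc_on_segments \<pi>" "x \<in> A"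
  shows "g x \<noteq> x"
proof
  assume gx: "g x = x"
  obtain l where l: "l < 3" "x \<in> S l" using A_cases[OF assms(2)] by blast
  obtain f :: "nat \<Rightarrow> bool" where "\<forall>u\<in>S l. f u \<noteq> f (g u) \<longleftrightarrow> u \<in> {x, \<pi> x}"
    by (rule cut_familyE[OF cut_family_tree_part[OF assms(1) l(1)] pairs_mem[OF l(2)]])
  then show False using l gx by force
qed

text \<open>If one of the two edges were a loop, both gluings would be the same set.\<close>

lemma card_gluings:
  assumes "g p \<noteq> p" "g q \<noteq> q"
  shows "card (gluings p q) = 2" "finite (gluings p q)"
proof -
  have "{(g p, g q), (p, q)} \<noteq> {(g p, q), (p, g q)}"
    using assms by (auto simp: doubleton_eq_iff)
  then show "card (gluings p q) = 2" "finite (gluings p q)" unfolding edge_gluings_eq by simp_all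
qed

text \<open>Two different gluings of the same edges would together identify both \<open>q\<close>
  and \<open>g q\<close> with \<open>p\<close>, which makes the edge \<open>q\<close> a
  loop.\<close>

lemma gluing_unique:
  assumes P: "partition_on A P" and "(q, g q) \<notin> part_rel P"
    and G: "G \<in> gluings p q" "G \<subseteq> part_rel P" and H: "H \<in> gluings p q" "H \<subseteq> part_rel P"
  shows "G = H"
proof (rule ccontr)
  assume "G \<noteq> H"
  then have "(p, q) \<in> G \<union> H" "(p, g q) \<in> G \<union> H"
    using G(1) H(1) unfolding edge_gluings_eq by auto
  then have "(p, q) \<in> part_rel P" "(p, g q) \<in> part_rel P"
    using G(2) H(2) by auto
  then show False using assms(2) part_rel_trans[OF P part_rel_sym] by blast
qed

lemma same_ends_imp_gluing:
  assumes "same_ends g r p q"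
  obtains G where "G \<in> gluings p q" "G \<subseteq> r"
proof -
  have "\<exists>G\<in>gluings p q. G \<subseteq> r"
    using assms unfolding edge_gluings_eq same_ends_def by simp
  then show thesis using that by blast
qed

lemma tree_type_imp_glued:
  assumes P: "partition_on A P" and T: "tree_type_244 ms P"
  obtains \<pi> i j k p q p' q' G G' where "\<pi> permutes A" "gluing_data \<pi> i j k p q p' q'"
    "G \<in> gluings p q" "G' \<in> gluings p' q'" "P = glued \<pi> G G'"
proof -
  obtain i j k p q p' q' G G' where T1: "\<forall>l<3. double_tree (cycle_quotient ms P l)"
    and ijk: "{i, j, k} = {0, 1, 2}" and pS: "p \<in> S j" "q \<in> S i" "p' \<in> S j" "q' \<in> S k"
    and G: "G \<in> gluings p q" "G' \<in> gluings p' q'"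
    and ne: "edge_class (cycle_quotient ms P j) p \<noteq> edge_class (cycle_quotient ms P j) p'"
    and gen: "P = generated_part (points ms) ((\<Union>l<3. part_rel (restrict_part P (S l))) \<union> G \<union> G')"
    using T unfolding tree_type_244_def by (elim conjE exE bexE) (erule that, assumption+)
  have "\<forall>l. \<exists>\<pi>. l < 3 \<longrightarrow> pairing_on (S l) \<pi> \<and> noncrossing_on (S l) \<pi> \<and>
      restrict_part P (S l) = tree_part \<pi> l"
    using double_tree_restrict_imp[OF P] T1 by metis
  then obtain h where h: "\<And>l. l < 3 \<Longrightarrow> pairing_on (S l) (h l) \<and> noncrossing_on (S l) (h l) \<and>
      restrict_part P (S l) = tree_part (h l) l"
    by metis
  \<comment> \<open>The three pairings are patched together; the value \<open>x\<close> outside the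
    segments makes the result a permutation of \<open>A\<close>.\<close>
  define \<pi> where "\<pi> x = (if x \<in> S 0 then h 0 x else if x \<in> S 1 then h 1 x else if x \<in> S 2 then h 2 x else x)" for x
  have \<pi>: "\<pi> x = h l x" if "x \<in> S l" "l < 3" for x l
  proof -
    have "l = 0 \<or> l = 1 \<or> l = 2" using that(2) by linarith
    then show ?thesis
      using that S_unique[of x 0 l] S_unique[of x 1 l] S_unique[of x 2 l] unfolding \<pi>_def by auto
  qed
  have pair: "pairing_on (S l) \<pi>" if "l < 3" for l
    using h[OF that] \<pi>[OF _ that] by (simp add: pairing_on_def)
  have nc: "nc_on_segments \<pi>"
    unfolding nc_on_segments_def
  proof (intro allI impI conjI pair)
    fix l :: nat assume l: "l < 3"
    show "noncrossing_on (S l) \<pi>"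
      using h[OF l] \<pi>[OF _ l] unfolding noncrossing_on_def by metis
  qed
  have tp: "restrict_part P (S l) = tree_part \<pi> l" if "l < 3" for l
  proof -
    have "pair_rel (S l) g (h l) = pair_rel (S l) g \<pi>"
      unfolding pair_rel_def using \<pi>[OF _ that] by (intro image_cong) auto
    then show ?thesis using h[OF that] by (simp add: pair_part_def)
  qed
  have perm: "\<pi> permutes A"
  proof (rule involution_permutes)
    show "\<pi> x \<in> A \<and> \<pi> (\<pi> x) = x" if "x \<in> A" for x
      using pairing_onD[OF pairing_on_A[OF nc] that] by blast
    show "\<pi> x = x" if "x \<notin> A" for x using that unfolding A_eq \<pi>_def by simp
  qed
  have j: "j < 3" by (rule three_distinct(2)[OF ijk])
  have cl: "edge_class (cycle_quotient ms P j) x = {x, \<pi> x}" if "x \<in> S j" for x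
    unfolding cycle_quotient_eq unfolding tp[OF j] by (rule double_tree_tree_part(2)[OF nc j that])
  have "p' \<notin> {p, \<pi> p}"
  proof
    assume "p' \<in> {p, \<pi> p}"
    then have "{p', \<pi> p'} = {p, \<pi> p}" using pairing_onD[OF pair[OF j] pS(1)] by auto
    then show False using ne cl pS by simp
  qed
  then have data: "gluing_data \<pi> i j k p q p' q'"
    using nc ijk pS by (simp add: gluing_data_def)
  have "P = glued \<pi> G G'"
    using gen tp unfolding points_eq glued_def glue_rel_def by simp
  then show thesis by (rule that[OF perm data G])
qed

lemma pairs_eq_cycle_part:
  assumes "nc_on_segments \<pi>"
  shows "cycle_part A \<pi> = pairs A \<pi>"
  unfolding cycle_part_def pairs_def
  using pairing_onD[OF pairing_on_A[OF assms]] by (intro image_cong) (simp_all add: orbit_involution)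

text \<open>The factors have disjoint supports, so each is recovered from the product by restriction
  to its segment and extension by the identity.\<close>

lemma NC2_segments:
  "(\<exists>p1\<in>NC2 (S 0). \<exists>p2\<in>NC2 (S 1). \<exists>p3\<in>NC2 (S 2). \<pi> = p1 \<circ> p2 \<circ> p3) \<longleftrightarrow>
     \<pi> permutes A \<and> nc_on_segments \<pi>"
proof
  have NC2: "f permutes T \<and> pairing_on T f \<and> noncrossing_on T f" if "f \<in> NC2 T" for f T
    using that permutes_in_image[of f T] by (auto simp: NC2_def pairing_on_def noncrossing_on_def)
  assume "\<exists>p1\<in>NC2 (S 0). \<exists>p2\<in>NC2 (S 1). \<exists>p3\<in>NC2 (S 2). \<pi> = p1 \<circ> p2 \<circ> p3"
  then obtain p1 p2 p3 where p: "p1 \<in> NC2 (S 0)" "p2 \<in> NC2 (S 1)" "p3 \<in> NC2 (S 2)" "\<pi> = p1 \<circ> p2 \<circ> p3"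
    by blast
  note n = NC2[OF p(1)] NC2[OF p(2)] NC2[OF p(3)]
  have dis: "S 0 \<inter> S 1 = {}" "S 0 \<inter> S 2 = {}" "S 1 \<inter> S 2 = {}" 
    using S_disjoint[of 0 1] S_disjoint[of 0 2] S_disjoint[of 1 2] by simp_all
  have out: "p1 x = x" if "x \<notin> S 0" for x using n(1) that permutes_not_in[of p1 "S 0" x] by blast
  have out2: "p2 x = x" if "x \<notin> S 1" for x using n(2) that permutes_not_in[of p2 "S 1" x] by blast
  have out3: "p3 x = x" if "x \<notin> S 2" for x using n(3) that permutes_not_in[of p3 "S 2" x] by blast
  have e0: "\<pi> x = p1 x" if "x \<in> S 0" for x
  proof -
    have "x \<notin> S 1" "x \<notin> S 2" using that dis by blast+
    then show ?thesis using out2 out3 p(4) by simp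
  qed
  have e1: "\<pi> x = p2 x" if "x \<in> S 1" for x
  proof -
    have "x \<notin> S 2" using that dis by blast
    moreover have "p2 x \<notin> S 0" using n(2) that dis unfolding pairing_on_def by blast
    ultimately show ?thesis using out out3 p(4) by simp
  qed
  have e2: "\<pi> x = p3 x" if "x \<in> S 2" for x
  proof -
    have "p3 x \<in> S 2" using n(3) that unfolding pairing_on_def by blast
    then have "p3 x \<notin> S 0" "p3 x \<notin> S 1" using dis by blast+
    then show ?thesis using out out2 p(4) by simp
  qed
  have "\<pi> permutes A"
    unfolding p(4)
    using n S_subset[of 0] S_subset[of 1] S_subset[of 2]
    by (intro permutes_compose) (auto elim: permutes_subset)
  moreover have tr: "pairing_on T \<pi> \<and> noncrossing_on T \<pi>"
    if "\<And>x. x \<in> T \<Longrightarrow> \<pi> x = f x" "pairing_on T f" "noncrossing_on T f" for T f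
    using that by (simp add: pairing_on_def noncrossing_on_def)
  have "nc_on_segments \<pi>"
    unfolding nc_on_segments_def all_less_three
    using tr[OF e0] tr[OF e1] tr[OF e2] n by blast
  ultimately show "\<pi> permutes A \<and> nc_on_segments \<pi>" by blast
next
  assume \<pi>: "\<pi> permutes A \<and> nc_on_segments \<pi>"
  then have nc: "nc_on_segments \<pi>" by blast
  define h where "h l x = (if x \<in> S l then \<pi> x else x)" for l x
  have h: "h l \<in> NC2 (S l)" if l: "l < 3" for l
  proof -
    note p = pairing_onD[OF nc_segD(1)[OF nc l]]
    have "h l permutes S l" by (rule involution_permutes) (use p in \<open>auto simp: h_def\<close>)
    moreover have "\<forall>x\<in>S l. h l x \<noteq> x \<and> h l (h l x) = x" using p by (simp add: h_def)
    moreover have "\<not> (\<exists>a\<in>S l. \<exists>b\<in>S l. a < b \<and> b < h l a \<and> h l a < h l b)"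
      using nc_segD(2)[OF nc l] by (simp add: h_def noncrossing_on_def)
    ultimately show ?thesis by (simp add: NC2_def)
  qed
  have "\<pi> x = (h 0 \<circ> h 1 \<circ> h 2) x" for x
  proof (cases "x \<in> A")
    case True
    then obtain l where l: "l < 3" "x \<in> S l" using A_cases by blast
    have \<pi>x: "\<pi> x \<in> S l" using pairing_onD[OF nc_segD(1)[OF nc l(1)] l(2)] by blast
    have "y \<notin> S l'" if "y \<in> S l" "l' < 3" "l' \<noteq> l" for y l' using S_unique[OF _ that(1) that(2) l(1)] that by blast
    then have o: "h l' x = x" "h l' (\<pi> x) = \<pi> x" if "l' < 3" "l' \<noteq> l" for l'
      using that l \<pi>x by (simp_all add: h_def)
    have hl: "h l x = \<pi> x" using l by (simp add: h_def)
    have "l = 0 \<or> l = 1 \<or> l = 2" using l by linarith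
    then show ?thesis
    proof (elim disjE)
      assume "l = 0"
      then show ?thesis using o(1)[of 1] o(1)[of 2] hl by simp
    next
      assume "l = 1"
      then show ?thesis using o(1)[of 2] o(2)[of 0] hl by simp
    next
      assume "l = 2"
      then show ?thesis using o(2)[of 0] o(2)[of 1] hl by simp
    qed
  next
    case False
    then have "x \<notin> S 0" "x \<notin> S 1" "x \<notin> S 2" unfolding A_eq by blast+
    moreover have "\<pi> x = x" by (rule permutes_not_in[OF conjunct1[OF \<pi>] False])
    ultimately show ?thesis by (simp add: h_def)
  qed
  then show "\<exists>p1\<in>NC2 (S 0). \<exists>p2\<in>NC2 (S 1). \<exists>p3\<in>NC2 (S 2). \<pi> = p1 \<circ> p2 \<circ> p3"
    using h[of 0] h[of 1] h[of 2] by (intro bexI[of _ "h 0"] bexI[of _ "h 1"] bexI[of _ "h 2"]) auto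
qed

lemma S_subset_orbit:
  assumes l: "l < 3"
  shows "S l \<subseteq> orbit g (first l)"
proof -
  have fin: "g x = Suc x" if "first l \<le> x" "x < final l" for x
    using g_on_S[OF l, of x] that S_eq[OF l] by simp
  have gf: "g (final l) = first l" using g_on_S[OF l, of "final l"] first_le_final S_eq[OF l] by simp
  have up: "x \<in> orbit g (first l)" if "Suc (first l) \<le> x" "x \<le> final l" for x
    using that
  proof (induction rule: dec_induct)
    case base
    then show ?case using orbit.base[of g "first l"] fin[of "first l"] by simp
  next
    case (step n)
    then show ?case using orbit.step[of n g "first l"] fin[of n] by simp
  qed
  \<comment> \<open>\<open>orbit\<close> starts with the image of its argument, so
    \<open>first l\<close> itself is reached only by the wrap-around, which in a one-point segment
    is the very first step.\<close>
  have "first l \<in> orbit g (first l)"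
  proof (cases "first l = final l")
    case True
    then show ?thesis using orbit.base[of g "first l"] gf by simp
  next
    case False
    then have "final l \<in> orbit g (first l)" using up first_le_final[of l] by simp
    then show ?thesis using orbit.step[of "final l" g "first l"] gf by simp
  qed
  then show ?thesis using up unfolding S_eq[OF l] by (metis Suc_leI atLeastAtMost_iff le_neq_implies_less subsetI)
qed

lemma orbit_subset_S:
  assumes l: "l < 3" and x: "x \<in> S l"
  shows "orbit g x \<subseteq> S l"
proof
  fix y assume "y \<in> orbit g x"
  then show "y \<in> S l" by induction (use g_S[OF l] x in blast)+
qed

definition merge_condition :: "(nat \<Rightarrow> nat) \<Rightarrow> nat set set \<Rightarrow> bool" where
  "merge_condition \<pi> V \<longleftrightarrow> (\<exists>B1\<in>V. \<exists>B2\<in>V. B1 \<noteq> B2 \<and>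
     (\<forall>B\<in>{B1, B2}. \<exists>C\<in>pairs A \<pi>. \<exists>D\<in>pairs A \<pi>. C \<noteq> D \<and> B = C \<union> D) \<and>
     (\<forall>B\<in>V - {B1, B2}. B \<in> pairs A \<pi>))"

lemma PS_iff:
  "(V, \<pi>) \<in> PS_NC2_211 m1 m2 m3 \<longleftrightarrow> \<pi> permutes A \<and> nc_on_segments \<pi> \<and> partition_on A V \<and>
     merge_condition \<pi> V \<and> part_join A V (cycle_part A g) = {A}"
proof (cases "nc_on_segments \<pi>")
  case True
  then show ?thesis
    unfolding PS_NC2_211_def Let_def mem_Collect_eq case_prod_conv NC2_segments
      pairs_eq_cycle_part[OF True] merge_condition_def by blast
next
  case False
  then show ?thesis
    unfolding PS_NC2_211_def Let_def mem_Collect_eq case_prod_conv NC2_segments by blast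
qed

text \<open>The definition only asks for two fused blocks of two cycles each; that they link the
  segments in a path comes from the join. If no fused block linked \<open>S l\<close> to its
  complement, the indicator of \<open>S l\<close> would be constant on the blocks of
  \<open>V\<close> and on the cycles of \<open>\<gamma>\<close>, hence on all of
  \<open>A\<close>.\<close>

lemma PS_imp_gluing_data:
  assumes "(V, \<pi>) \<in> PS_NC2_211 m1 m2 m3"
  obtains i j k p q p' q' where "\<pi> permutes A" "gluing_data \<pi> i j k p q p' q'" "V = merged \<pi> p q p' q'"
proof -
  from assms have perm: "\<pi> permutes A" and nc: "nc_on_segments \<pi>" and V: "partition_on A V"
    and mc: "merge_condition \<pi> V" and join: "part_join A V (cycle_part A g) = {A}"
    unfolding PS_iff by blast+
  from mc obtain B1 B2 where B: "B1 \<in> V" "B2 \<in> V" "B1 \<noteq> B2"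
    and B1: "\<exists>C\<in>pairs A \<pi>. \<exists>D\<in>pairs A \<pi>. C \<noteq> D \<and> B1 = C \<union> D"
    and B2: "\<exists>C\<in>pairs A \<pi>. \<exists>D\<in>pairs A \<pi>. C \<noteq> D \<and> B2 = C \<union> D"
    and rest: "\<And>B. B \<in> V \<Longrightarrow> B \<noteq> B1 \<Longrightarrow> B \<noteq> B2 \<Longrightarrow> B \<in> pairs A \<pi>"
    unfolding merge_condition_def by (elim bexE conjE) simp
  obtain a b where ab: "a \<in> A" "b \<in> A" "B1 = {a, \<pi> a} \<union> {b, \<pi> b}"
    using B1 unfolding pairs_def by (elim bexE conjE imageE) simp
  obtain c d where cd: "c \<in> A" "d \<in> A" "B2 = {c, \<pi> c} \<union> {d, \<pi> d}"
    using B2 unfolding pairs_def by (elim bexE conjE imageE) simp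
  obtain la where la: "la < 3" "a \<in> S la" using A_cases[OF ab(1)] by blast
  obtain lb where lb: "lb < 3" "b \<in> S lb" using A_cases[OF ab(2)] by blast
  obtain lc where lc: "lc < 3" "c \<in> S lc" using A_cases[OF cd(1)] by blast
  obtain ld where ld: "ld < 3" "d \<in> S ld" using A_cases[OF cd(2)] by blast
  have \<pi>S: "\<pi> x \<in> S l \<longleftrightarrow> x \<in> S l" if "x \<in> A" "l < 3" for x l
    using pairing_onD[OF nc_segD(1)[OF nc that(2)]] pairing_onD[OF pairing_on_A[OF nc] that(1)] by metis
  have "(la = l) \<noteq> (lb = l) \<or> (lc = l) \<noteq> (ld = l)" if l: "l < 3" for l
  proof (rule ccontr)
    assume "\<not> ?thesis"
    then have eq: "a \<in> S l \<longleftrightarrow> b \<in> S l" "c \<in> S l \<longleftrightarrow> d \<in> S l"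
      using la lb lc ld S_unique[OF _ _ l] by metis+
    define f where "f u \<longleftrightarrow> u \<in> S l" for u
    have pr: "f u = f v" if "x \<in> A" "u \<in> {x, \<pi> x}" "v \<in> {x, \<pi> x}" for x u v
      using that \<pi>S[OF that(1) l] by (auto simp: f_def)
    have 1: "f u = f v" if uv: "(u, v) \<in> part_rel V" for u v
    proof -
      obtain B where B: "B \<in> V" "u \<in> B" "v \<in> B" using uv unfolding part_rel_def by blast
      have fB1: "f w = f a" if "w \<in> B1" for w
        using that pr[OF ab(1), of w a] pr[OF ab(2), of w b] eq unfolding ab(3) by (auto simp: f_def)
      have fB2: "f w = f c" if "w \<in> B2" for w
        using that pr[OF cd(1), of w c] pr[OF cd(2), of w d] eq unfolding cd(3) by (auto simp: f_def)
      show ?thesis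
      proof (cases "B = B1 \<or> B = B2")
        case True
        then show ?thesis using fB1 fB2 B by metis
      next
        case False
        then obtain x where "x \<in> A" "B = {x, \<pi> x}" using rest B(1) unfolding pairs_def by blast
        then show ?thesis using pr B by blast
      qed
    qed
    have 2: "f u = f v" if uv: "(u, v) \<in> part_rel (cycle_part A g)" for u v
    proof -
      obtain x where x: "x \<in> A" "u \<in> orbit g x" "v \<in> orbit g x"
        using uv unfolding part_rel_def cycle_part_def by blast
      then obtain l' where l': "l' < 3" "x \<in> S l'" using A_cases by blast
      then have uv: "u \<in> S l'" "v \<in> S l'" using orbit_subset_S[OF l'] x by blast+
      then show ?thesis unfolding f_def using S_unique[OF _ _ l l'(1)] by metis
    qed
    have all: "f u = f v" if "u \<in> A" "v \<in> A" for u v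
    proof (rule generated_part_respects[where f = f and R = "part_rel V \<union> part_rel (cycle_part A g)"])
      show "\<forall>(u, v)\<in>part_rel V \<union> part_rel (cycle_part A g). f u = f v" using 1 2 by blast
      show "(u, v) \<in> part_rel (generated_part A (part_rel V \<union> part_rel (cycle_part A g)))"
        using join that unfolding part_join_def by (simp add: part_rel_def)
    qed
    \<comment> \<open>Another segment supplies a point where the indicator is false.\<close>
    obtain l' :: nat where l': "l' < 3" "l' \<noteq> l"
      using that[of "if l = 0 then 1 else 0"] by (simp split: if_splits)
    have fS: "first l \<in> S l" "first l' \<in> S l'" using S_eq l l' first_le_final by auto
    then have "first l' \<notin> S l" using S_unique[OF _ _ l l'(1)] l' by blast
    then show False
      using all[of "first l" "first l'"] fS S_subset[OF l] S_subset[OF l'(1)] unfolding f_def by blast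
  qed
  from two_edges_span_three[OF la(1) lb(1) lc(1) ld(1) this]
  obtain i j k where ijk: "{i, j, k} = {0, 1, 2}"
    and lab: "la = j \<and> lb = i \<or> la = i \<and> lb = j" and lcd: "lc = j \<and> ld = k \<or> lc = k \<and> ld = j"
    by blast
  obtain p q where pq: "p \<in> S j" "q \<in> S i" "B1 = {p, \<pi> p} \<union> {q, \<pi> q}"
    using lab
  proof
    assume "la = j \<and> lb = i"
    then show thesis using that[of a b] la lb ab by simp
  next
    assume "la = i \<and> lb = j"
    then show thesis using that[of b a] la lb ab Un_commute by metis
  qed
  obtain p' q' where pq': "p' \<in> S j" "q' \<in> S k" "B2 = {p', \<pi> p'} \<union> {q', \<pi> q'}"
    using lcd
  proof
    assume "lc = j \<and> ld = k"
    then show thesis using that[of c d] lc ld cd by simp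
  next
    assume "lc = k \<and> ld = j"
    then show thesis using that[of d c] lc ld cd Un_commute by metis
  qed
  have disj: "B1 \<inter> B2 = {}" by (rule disjointD[OF partition_onD2[OF V] B])
  have "p' \<in> B2" "{p, \<pi> p} \<subseteq> B1" using pq pq' by auto
  then have "p' \<notin> {p, \<pi> p}" using disj by blast
  then have data: "gluing_data \<pi> i j k p q p' q'"
    using nc ijk pq pq' by (simp add: gluing_data_def)
  \<comment> \<open>One inclusion suffices, as both sides are partitions of
    \<open>A\<close>.\<close>
  have "V \<subseteq> merged \<pi> p q p' q'"
  proof
    fix X assume X: "X \<in> V"
    show "X \<in> merged \<pi> p q p' q'"
    proof (cases "X = B1 \<or> X = B2")
      case True
      then show ?thesis unfolding merged_def pq(3) pq'(3) by blast
    next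
      case False
      then have "X \<inter> B1 = {}" "X \<inter> B2 = {}" "X \<in> pairs A \<pi>"
        using disjointD[OF partition_onD2[OF V] X] B rest[OF X] by blast+
      moreover from this have "X \<notin> {{p, \<pi> p}, {q, \<pi> q}, {p', \<pi> p'}, {q', \<pi> q'}}"
        unfolding pq(3) pq'(3) by auto
      ultimately show ?thesis unfolding merged_def by blast
    qed
  qed
  then have "V = merged \<pi> p q p' q'"
    by (rule partition_on_subset_eq[OF V partition_on_merged[OF data]])
  then show thesis by (rule that[OF perm data])
qed

lemma gluing_data_imp_PS:
  assumes perm: "\<pi> permutes A" and data: "gluing_data \<pi> i j k p q p' q'"
  shows "(merged \<pi> p q p' q', \<pi>) \<in> PS_NC2_211 m1 m2 m3"
proof -
  let ?V = "merged \<pi> p q p' q'"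
  let ?B1 = "{p, \<pi> p} \<union> {q, \<pi> q}" and ?B2 = "{p', \<pi> p'} \<union> {q', \<pi> q'}"
  note nc = nc[OF data] and ijk = ijk[OF data] and pS = pS[OF data] and ne = ne[OF data]
  note lt = three_distinct(1-3)[OF ijk] and neq = three_distinct(4-6)[OF ijk]
  have pA: "p \<in> A" "q \<in> A" "p' \<in> A" "q' \<in> A" using pS S_subset lt by blast+
  have V: "partition_on A ?V" by (rule partition_on_merged[OF data])
  have B: "?B1 \<in> ?V" "?B2 \<in> ?V" unfolding merged_def by blast+
  have \<pi>S: "{x, \<pi> x} \<subseteq> S l" if "x \<in> S l" "l < 3" for x l
    using pairing_onD[OF nc_segD(1)[OF nc that(2)] that(1)] that by blast
  have "p' \<notin> {q, \<pi> q}" using \<pi>S[OF pS(2) lt(1)] pS(3) S_disjoint[OF lt(1,2) neq(1)] by blast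
  then have B12: "?B1 \<noteq> ?B2" using ne by blast
  have d: "{x, \<pi> x} \<noteq> {y, \<pi> y}" if "x \<in> S l" "y \<in> S l'" "l < 3" "l' < 3" "l \<noteq> l'" for x y l l'
    using \<pi>S[OF that(1,3)] \<pi>S[OF that(2,4)] S_disjoint[OF that(3-5)] by blast
  have mc: "merge_condition \<pi> ?V"
    unfolding merge_condition_def
  proof (rule bexI[OF _ B(1)], rule bexI[OF _ B(2)], intro conjI B12)
    have "\<exists>C\<in>pairs A \<pi>. \<exists>D\<in>pairs A \<pi>. C \<noteq> D \<and> ?B1 = C \<union> D"
      by (intro bexI[OF _ pairs_mem[OF pA(1)]] bexI[OF _ pairs_mem[OF pA(2)]] conjI refl
          d[OF pS(1,2) lt(2,1) neq(1)[symmetric]])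
    moreover have "\<exists>C\<in>pairs A \<pi>. \<exists>D\<in>pairs A \<pi>. C \<noteq> D \<and> ?B2 = C \<union> D"
      by (intro bexI[OF _ pairs_mem[OF pA(3)]] bexI[OF _ pairs_mem[OF pA(4)]] conjI refl
          d[OF pS(3,4) lt(2,3) neq(3)])
    ultimately show "\<forall>B\<in>{?B1, ?B2}. \<exists>C\<in>pairs A \<pi>. \<exists>D\<in>pairs A \<pi>. C \<noteq> D \<and> B = C \<union> D"
      by (intro ballI) (elim insertE emptyE; simp only:)
    show "\<forall>B\<in>?V - {?B1, ?B2}. B \<in> pairs A \<pi>" unfolding merged_def by blast
  qed
  let ?J = "part_join A ?V (cycle_part A g)"
  have J: "partition_on A ?J" unfolding part_join_def by (rule partition_on_generated)
  have sub: "part_rel ?V \<union> part_rel (cycle_part A g) \<subseteq> A \<times> A"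
  proof -
    have "orbit g x \<subseteq> A" if x: "x \<in> A" for x
    proof -
      obtain l where l: "l < 3" "x \<in> S l" using A_cases[OF x] by blast
      then show ?thesis using orbit_subset_S[OF l] S_subset[OF l(1)] by blast
    qed
    then have "part_rel (cycle_part A g) \<subseteq> A \<times> A" unfolding part_rel_def cycle_part_def by blast
    then show ?thesis using part_rel_mem[OF V] by auto
  qed
  have le: "part_rel ?V \<subseteq> part_rel ?J" "part_rel (cycle_part A g) \<subseteq> part_rel ?J"
    using generated_part_superset[OF sub] unfolding part_join_def by blast+
  have seg: "(x, y) \<in> part_rel ?J" if xy: "x \<in> S l" "y \<in> S l" and l: "l < 3" for x y l
  proof -
    have "first l \<in> A" using S_subset[OF l] first_le_final[of l] S_eq[OF l] by auto
    then have "orbit g (first l) \<in> cycle_part A g" unfolding cycle_part_def by (rule imageI)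
    then have "(x, y) \<in> part_rel (cycle_part A g)"
      using subsetD[OF S_subset_orbit[OF l]] xy by (auto simp: part_rel_def)
    then show ?thesis using le by blast
  qed
  have qp: "(q, p) \<in> part_rel ?J" "(q', p') \<in> part_rel ?J"
    by (rule subsetD[OF le(1) part_relI[OF B(1)]], simp, simp)
      (rule subsetD[OF le(1) part_relI[OF B(2)]], simp, simp)
  \<comment> \<open>Each segment lies in one block of the join; the first fused block links
    \<open>S i\<close> to the middle segment, which contains \<open>p\<close>, and the second links
    \<open>S k\<close> to it.\<close>
  have toP: "(x, p) \<in> part_rel ?J" if x: "x \<in> A" for x
  proof -
    from x consider "x \<in> S i" | "x \<in> S j" | "x \<in> S k" unfolding A_eq_perm[OF ijk] by blast
    then show ?thesis
    proof cases
      case 1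
      then show ?thesis using part_rel_trans[OF J seg[OF 1 pS(2) lt(1)] qp(1)] by simp
    next
      case 2
      then show ?thesis using seg[OF 2 pS(1) lt(2)] by blast
    next
      case 3
      then show ?thesis
        using part_rel_trans[OF J part_rel_trans[OF J seg[OF 3 pS(4) lt(3)] qp(2)] seg[OF pS(3,1) lt(2)]] by simp
    qed
  qed
  have "part_rel ?J = part_rel {A}"
  proof -
    have "A \<times> A \<subseteq> part_rel ?J"
    proof clarify
      fix x y assume "x \<in> A" "y \<in> A"
      then show "(x, y) \<in> part_rel ?J"
        by (intro part_rel_trans[OF J toP part_rel_sym[OF toP]])
    qed
    moreover have "part_rel ?J \<subseteq> A \<times> A" using equiv_part_rel[OF J] by (simp add: equiv_def)
    ultimately have "part_rel ?J = A \<times> A" by (intro equalityI)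
    also have "\<dots> = part_rel {A}" by (auto simp only: part_rel_def)
    finally show ?thesis .
  qed
  moreover have "partition_on A {A}" using pA by (intro partition_on_space) blast
  ultimately have "?J = {A}" using part_rel_inject[OF J] by blast
  then show ?thesis unfolding PS_iff using perm nc V mc by blast
qed


section \<open>Counting the fibres\<close>

text \<open>The blocks are read from the edge classes of the whole graph, the pairing from those of
  the single trees. Requiring \<open>permutes\<close> fixes the pairing outside \<open>A\<close>, so
  that at most one reading exists.\<close>

definition reads_off :: "nat set set \<Rightarrow> nat set set \<times> (nat \<Rightarrow> nat) \<Rightarrow> bool" where
  "reads_off P y \<longleftrightarrow> fst y = A // edge_equiv (cycles_quotient ms P) \<and> snd y permutes A \<and>
     (\<forall>l<3. \<forall>x\<in>S l. edge_class (cycle_quotient ms P l) x = {x, snd y x})"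

lemma reads_off_unique:
  assumes y: "reads_off P y" and z: "reads_off P z"
  shows "y = z"
proof (rule prod_eqI)
  show "fst y = fst z" using y z by (simp add: reads_off_def)
  show "snd y = snd z"
  proof
    fix x
    show "snd y x = snd z x"
    proof (cases "x \<in> A")
      case True
      then obtain l where l: "l < 3" "x \<in> S l" using A_cases by blast
      have "edge_class (cycle_quotient ms P l) x = {x, snd y x}"
        using y l unfolding reads_off_def by blast
      moreover have "edge_class (cycle_quotient ms P l) x = {x, snd z x}"
        using z l unfolding reads_off_def by blast
      ultimately have "{x, snd y x} = {x, snd z x}" by simp
      then show ?thesis unfolding doubleton_eq_iff by auto
    next
      case False
      have "snd y x = x" "snd z x = x"
        using y z False permutes_not_in unfolding reads_off_def by metis+
      then show ?thesis by simp
    qed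
  qed
qed

lemma reads_off_glued:
  assumes "\<pi> permutes A" and data: "gluing_data \<pi> i j k p q p' q'"
    and G: "G \<in> gluings p q" "G' \<in> gluings p' q'"
  shows "reads_off (glued \<pi> G G') (merged \<pi> p q p' q', \<pi>)"
  using edge_classes_glued[OF data G] local_edge_class_glued[OF data G] assms(1)
  by (simp add: reads_off_def)

lemma T244_iff: "P \<in> T244 m1 m2 m3 \<longleftrightarrow> partition_on A P \<and> tree_type_244 ms P"
  by (simp add: T244_def)

text \<open>This lets any two members of an edge class take over the role of the edges along which
  \<open>P\<close> was originally glued.\<close>

lemma same_class_imp_gluing:
  assumes P: "partition_on A P" and V: "V = A // edge_equiv (cycles_quotient ms P)"
    and B: "B \<in> V" "p \<in> B" "q \<in> B"
  obtains G where "G \<in> gluings p q" "G \<subseteq> part_rel P"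
proof -
  have eq: "equiv A (edge_equiv (cycles_quotient ms P))"
    using equiv_edge_equiv[of "fun_quotient A g P"]
    unfolding cycles_quotient_eq by (simp add: quotient_graph_def)
  have "(p, q) \<in> edge_equiv (cycles_quotient ms P)"
    using quotient_eq_iff[OF eq, of B B p q] B V by simp
  then have "same_ends g (part_rel P) p q"
    unfolding cycles_quotient_eq edge_equiv_fun_quotient[OF P subset_refl g_A] by blast
  then show thesis by (rule same_ends_imp_gluing[OF _ that])
qed

text \<open>The common partition contains both gluings of each pair of edges and has no loops, so
  \<open>gluing_unique\<close> applies.\<close>

lemma glued_inject:
  assumes data: "gluing_data \<pi> i j k p q p' q'"
    and G: "G \<in> gluings p q" "G' \<in> gluings p' q'" and H: "H \<in> gluings p q" "H' \<in> gluings p' q'"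
    and eq: "glued \<pi> G G' = glued \<pi> H H'"
  shows "G = H" "G' = H'"
proof -
  let ?P = "glued \<pi> G G'"
  note ijk = ijk[OF data] and pS = pS[OF data]
  note lt = three_distinct(1-3)[OF ijk]
  have qA: "q \<in> A" "q' \<in> A" using pS S_subset lt by blast+
  have P: "partition_on A ?P" unfolding glued_def by (rule partition_on_generated)
  have "G \<union> G' \<subseteq> part_rel ?P"
    using glue_rel_le[OF data G] unfolding glue_rel_def by blast
  moreover have "H \<union> H' \<subseteq> part_rel ?P"
    using glue_rel_le[OF data H] unfolding glue_rel_def eq by blast
  ultimately show "G = H" "G' = H'"
    using gluing_unique[OF P no_loops_glued[OF data G qA(1)] G(1) _ H(1)]
      gluing_unique[OF P no_loops_glued[OF data G qA(2)] G(2) _ H(2)] by auto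
qed

text \<open>
  If two partitions of 2-4-4 tree type have the same pairing and the same edge classes, and one
  refines the other, then they agree: edges glued in the coarser one are equivalent in the finer
  one, where the opposite gluing would produce a loop in the coarser one.
\<close>

lemma glued_eqI:
  assumes data: "gluing_data \<pi> i j k p q p' q'" and data2: "gluing_data \<pi> i2 j2 k2 p2 q2 p2' q2'"
    and V: "merged \<pi> p q p' q' = merged \<pi> p2 q2 p2' q2'"
    and G: "G \<in> gluings p q" "G' \<in> gluings p' q'" and H: "H \<in> gluings p2 q2" "H' \<in> gluings p2' q2'"
    and sub: "G \<subseteq> part_rel (glued \<pi> H H')" "G' \<subseteq> part_rel (glued \<pi> H H')"
  shows "glued \<pi> G G' = glued \<pi> H H'"
proof -
  let ?P = "glued \<pi> G G'" and ?R = "glued \<pi> H H'"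
  note ijk2 = ijk[OF data2] and pS2 = pS[OF data2]
  note lt = three_distinct(1-3)[OF ijk2]
  have P: "partition_on A ?P" and R: "partition_on A ?R"
    unfolding glued_def by (rule partition_on_generated)+
  have leR: "glue_rel \<pi> H H' \<subseteq> part_rel ?R" by (rule glue_rel_le[OF data2 H])
  have leP: "glue_rel \<pi> G G' \<subseteq> part_rel ?P" by (rule glue_rel_le[OF data G])
  have "glue_rel \<pi> G G' \<subseteq> part_rel ?R"
    using leR sub unfolding glue_rel_def by blast
  then have PR: "part_rel ?P \<subseteq> part_rel ?R"
    unfolding glued_def[of \<pi> G G'] by (rule generated_part_least[OF R])
  have V2: "merged \<pi> p2 q2 p2' q2' = A // edge_equiv (cycles_quotient ms ?P)"
    using edge_classes_glued[OF data G] V by simp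
  have B: "{p2, \<pi> p2} \<union> {q2, \<pi> q2} \<in> merged \<pi> p2 q2 p2' q2'"
    "{p2', \<pi> p2'} \<union> {q2', \<pi> q2'} \<in> merged \<pi> p2 q2 p2' q2'"
    unfolding merged_def by blast+
  have qA: "q2 \<in> A" "q2' \<in> A" using pS2 S_subset lt by blast+
  have HR: "H \<subseteq> part_rel ?R" "H' \<subseteq> part_rel ?R" using leR unfolding glue_rel_def by blast+
  obtain K where K: "K \<in> gluings p2 q2" "K \<subseteq> part_rel ?P"
    by (rule same_class_imp_gluing[OF P V2 B(1), of p2 q2]) auto
  obtain K' where K': "K' \<in> gluings p2' q2'" "K' \<subseteq> part_rel ?P"
    by (rule same_class_imp_gluing[OF P V2 B(2), of p2' q2']) auto
  have "H = K"
    using gluing_unique[OF R no_loops_glued[OF data2 H qA(1)] H(1) HR(1) K(1)] K(2) PR by blast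
  moreover have "H' = K'"
    using gluing_unique[OF R no_loops_glued[OF data2 H qA(2)] H(2) HR(2) K'(1)] K'(2) PR by blast
  ultimately have "glue_rel \<pi> H H' \<subseteq> part_rel ?P"
    using leP K K' unfolding glue_rel_def by blast
  then have "part_rel ?R \<subseteq> part_rel ?P"
    unfolding glued_def[of \<pi> H H'] by (rule generated_part_least[OF P])
  then show ?thesis using PR by (intro part_rel_inject[OF P R]) blast
qed

text \<open>Gluing data for \<open>y\<close> are fixed once. A partition with this reading may have
  been built from other data, but \<open>p\<close>, \<open>q\<close> and likewise \<open>p'\<close>,
  \<open>q'\<close> are equivalent edges in it, so it contains gluings of them, and
  \<open>glued_eqI\<close> identifies it with the partition built from these gluings. Each of the
  two pairs of edges has 2 gluings, which gives 4.\<close>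

lemma card_fibre:
  assumes y: "y \<in> PS_NC2_211 m1 m2 m3"
  shows "card {P \<in> T244 m1 m2 m3. reads_off P y} = 4"
proof -
  obtain V \<pi> where yV: "y = (V, \<pi>)" by (cases y)
  obtain i j k p q p' q' where perm: "\<pi> permutes A" and data: "gluing_data \<pi> i j k p q p' q'"
    and V: "V = merged \<pi> p q p' q'"
    by (rule PS_imp_gluing_data[OF y[unfolded yV]])
  note nc = nc[OF data] and ijk = ijk[OF data] and pS = pS[OF data]
  note lt = three_distinct(1-3)[OF ijk]
  have pA: "p \<in> A" "q \<in> A" "p' \<in> A" "q' \<in> A" using pS S_subset lt by blast+
  let ?F = "\<lambda>(G, G'). glued \<pi> G G'"
  let ?D = "gluings p q \<times> gluings p' q'"
  have "{P \<in> T244 m1 m2 m3. reads_off P y} = ?F ` ?D"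
  proof
    show "?F ` ?D \<subseteq> {P \<in> T244 m1 m2 m3. reads_off P y}"
    proof clarify
      fix G G' assume G: "G \<in> gluings p q" "G' \<in> gluings p' q'"
      have "partition_on A (glued \<pi> G G')" unfolding glued_def by (rule partition_on_generated)
      then show "glued \<pi> G G' \<in> T244 m1 m2 m3 \<and> reads_off (glued \<pi> G G') y"
        unfolding T244_iff yV V using tree_type_glued[OF data G] reads_off_glued[OF perm data G] by blast
    qed
    show "{P \<in> T244 m1 m2 m3. reads_off P y} \<subseteq> ?F ` ?D"
    proof
      fix P assume "P \<in> {P \<in> T244 m1 m2 m3. reads_off P y}"
      then have P: "partition_on A P" "tree_type_244 ms P" "reads_off P y"
        unfolding mem_Collect_eq T244_iff by blast+
      obtain \<rho> i2 j2 k2 p2 q2 p2' q2' H H' where perm2: "\<rho> permutes A"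
        and data2: "gluing_data \<rho> i2 j2 k2 p2 q2 p2' q2'"
        and H: "H \<in> gluings p2 q2" "H' \<in> gluings p2' q2'" and PH: "P = glued \<rho> H H'"
        by (rule tree_type_imp_glued[OF P(1,2)])
      have "(merged \<rho> p2 q2 p2' q2', \<rho>) = (V, \<pi>)"
        using reads_off_unique reads_off_glued[OF perm2 data2 H] P(3) unfolding PH yV by blast
      then have \<rho>: "\<rho> = \<pi>" and V2: "merged \<pi> p q p' q' = merged \<pi> p2 q2 p2' q2'"
        using V by auto
      have VP: "merged \<pi> p q p' q' = A // edge_equiv (cycles_quotient ms P)"
        using P(3) unfolding reads_off_def yV V by simp
      have B: "{p, \<pi> p} \<union> {q, \<pi> q} \<in> merged \<pi> p q p' q'" "{p', \<pi> p'} \<union> {q', \<pi> q'} \<in> merged \<pi> p q p' q'"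
        unfolding merged_def by blast+
      obtain G where G: "G \<in> gluings p q" "G \<subseteq> part_rel P"
        by (rule same_class_imp_gluing[OF P(1) VP B(1), of p q]) auto
      obtain G' where G': "G' \<in> gluings p' q'" "G' \<subseteq> part_rel P"
        by (rule same_class_imp_gluing[OF P(1) VP B(2), of p' q']) auto
      have "glued \<pi> G G' = P"
        using glued_eqI[OF data data2[unfolded \<rho>] V2 G(1) G'(1) H] G(2) G'(2) unfolding PH \<rho> by blast
      then show "P \<in> ?F ` ?D" using G(1) G'(1) by (intro image_eqI[of _ _ "(G, G')"]) auto
    qed
  qed
  moreover have "inj_on ?F ?D"
  proof (rule inj_onI, clarify)
    fix G G' H H'
    assume "G \<in> gluings p q" "G' \<in> gluings p' q'" "H \<in> gluings p q" "H' \<in> gluings p' q'"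
      "glued \<pi> G G' = glued \<pi> H H'"
    then show "G = H \<and> G' = H'" using glued_inject[OF data] by blast
  qed
  moreover have "card ?D = 4"
    using card_gluings(1)[OF gamma_no_fixpoint[OF nc pA(1)] gamma_no_fixpoint[OF nc pA(2)]]
      card_gluings(1)[OF gamma_no_fixpoint[OF nc pA(3)] gamma_no_fixpoint[OF nc pA(4)]]
    by (simp add: card_cartesian_product)
  ultimately show ?thesis by (simp add: card_image)
qed

lemma card_readings:
  assumes "P \<in> T244 m1 m2 m3"
  shows "card {y \<in> PS_NC2_211 m1 m2 m3. reads_off P y} = 1"
proof -
  obtain \<pi> i j k p q p' q' G G' where perm: "\<pi> permutes A" and data: "gluing_data \<pi> i j k p q p' q'"
    and G: "G \<in> gluings p q" "G' \<in> gluings p' q'" and P: "P = glued \<pi> G G'"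
    using tree_type_imp_glued assms unfolding T244_iff by blast
  have "{y \<in> PS_NC2_211 m1 m2 m3. reads_off P y} = {(merged \<pi> p q p' q', \<pi>)}"
    using gluing_data_imp_PS[OF perm data] reads_off_glued[OF perm data G] reads_off_unique
    unfolding P by blast
  then show ?thesis by simp
qed

lemma card_T244: "card (T244 m1 m2 m3) = 4 * card (PS_NC2_211 m1 m2 m3)"
proof -
  have "T244 m1 m2 m3 \<subseteq> Pow (Pow A)"
    unfolding T244_def partition_on_def by blast
  then have T: "finite (T244 m1 m2 m3)" by (rule finite_subset) simp
  have "PS_NC2_211 m1 m2 m3 \<subseteq> Pow (Pow A) \<times> {p. p permutes A}"
  proof clarify
    fix V \<pi> assume "(V, \<pi>) \<in> PS_NC2_211 m1 m2 m3"
    then have "\<pi> permutes A" "\<Union>V = A" unfolding PS_iff partition_on_def by blast+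
    then show "V \<in> Pow (Pow A) \<and> \<pi> \<in> {p. p permutes A}" by blast
  qed
  then have PS: "finite (PS_NC2_211 m1 m2 m3)"
    by (rule finite_subset) (simp add: finite_permutations)
  \<comment> \<open>The pairs related by \<open>reads_off\<close> are counted in two ways: each
    \<open>P\<close> has one reading, and each \<open>y\<close> is read off from four
    partitions.\<close>
  have "(\<Sum>P\<in>T244 m1 m2 m3. card {y \<in> PS_NC2_211 m1 m2 m3. reads_off P y}) = 4 * card (PS_NC2_211 m1 m2 m3)"
    by (rule sum_multicount[OF T PS]) (use card_fibre in blast)
  then show ?thesis using card_readings by simp
qed

end

theorem lemma8p24:
  fixes m1 m2 m3 :: nat
  assumes "m1 \<ge> 1" and "m2 \<ge> 1" and "m3 \<ge> 1"
  shows "card (T244 m1 m2 m3) = 4 * card (PS_NC2_211 m1 m2 m3)"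
  by (rule three_cycles.card_T244) (unfold_locales, fact+)

end
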